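(* Let $G=(V_G,E_G)$ be an infinite directed graph with all vertices of finite degree, let $0<\theta<1$, and suppose that $G$ admits random paths with EIT($\theta$). Consider oriented percolation on $G$ with parameter $p\in(0,1)$. If $p>\theta$, then with probability $1$ there is a vertex $v$ in $G$ such that the oriented open cluster $\mathcal{C}(v)$ is transient.
   Context: Let $G=(V_G,E_G)$ be an infinite directed graph with all vertices of finite degree. For $v_0\in V_G$, let $\Upsilon(G,v_0)$ be the collection of infinite directed paths in $G$ which emanate from $v_0$ and tend to infinity (i.e. visit any vertex at most finitely many times). Viewed as a subset of $E_G^{\mathbf N}$ with the product topology, $\Upsilon(G,v_0)$ is a Borel set. For $0<\theta<1$, a Borel probability measure $\mu$ on $\Upsilon(G,v_0)$ has exponential intersection tails with parameter $\theta$, in short EIT($\theta$), if there exists a constant $C$ such that for all $n$, $$\mu\times\mu\{(\varphi,\psi): |\varphi\cap\psi|\ge n\}\le C\theta^n,$$ where $|\varphi\cap\psi|$ is the number of edges in the intersection of $\varphi$ and $\psi$. The graph $G$ admits random paths with EIT($\theta$) if such a measure $\mu$ exists for some basepoint $v_0\in V_G$. Oriented percolation on $G$ with parameter $p\in(0,1)$: each edge of $G$ is independently declared open with probability $p$ and closed with probability $1-p$. The oriented open cluster $\mathcal{C}(v)$ of a vertex $v$ is the union of all directed open paths emanating from $v$. A subgraph $\Lambda$ of $G$ is called transient if, when the orientations of the edges are ignored, $\Lambda$ is connected and simple random walk on it is a transient Markov chain (equivalently, the effective resistance from a vertex of $\Lambda$ to infinity is finite when each edge of $\Lambda$ is a unit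 resistor). *)

theory Defs
  imports "HOL-Probability.Probability" "Graph_Theory.Graph_Theory"
begin

definition locally_finite :: "('v, 'e) pre_digraph \<Rightarrow> bool" where
  "locally_finite G \<longleftrightarrow> (\<forall>v\<in>verts G. finite (in_arcs G v) \<and> finite (out_arcs G v))"


section \<open>Random paths\<close>

text \<open>Infinite directed paths are sequences of arcs; vertices and arcs may be repeated, but every
  vertex is visited only finitely often.\<close>

definition paths_to_infinity :: "('v, 'e) pre_digraph \<Rightarrow> 'v \<Rightarrow> (nat \<Rightarrow> 'e) set" where
  "paths_to_infinity G v\<^sub>0 = {\<phi>. (\<forall>i. \<phi> i \<in> arcs G) \<and> tail G (\<phi> 0) = v\<^sub>0 \<and>
     (\<forall>i. head G (\<phi> i) = tail G (\<phi> (Suc i))) \<and>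
     (\<forall>v\<in>verts G. finite {i. tail G (\<phi> i) = v})}"

definition path_topology :: "('v, 'e) pre_digraph \<Rightarrow> 'v \<Rightarrow> (nat \<Rightarrow> 'e) topology" where
  "path_topology G v\<^sub>0 = subtopology
     (product_topology (\<lambda>_::nat. discrete_topology (arcs G)) UNIV) (paths_to_infinity G v\<^sub>0)"

definition borel_prob_on_paths :: "('v, 'e) pre_digraph \<Rightarrow> 'v \<Rightarrow> (nat \<Rightarrow> 'e) measure \<Rightarrow> bool" where
  "borel_prob_on_paths G v\<^sub>0 \<mu> \<longleftrightarrow> prob_space \<mu> \<and> space \<mu> = paths_to_infinity G v\<^sub>0 \<and>
     sets \<mu> = sigma_sets (paths_to_infinity G v\<^sub>0) {U. openin (path_topology G v\<^sub>0) U}"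

text \<open>The intersection of two paths is the set of arcs they have in common. It may be infinite, in
  which case \<open>card\<close> would be \<open>0\<close>.\<close>

definition EIT :: "(nat \<Rightarrow> 'e) measure \<Rightarrow> real \<Rightarrow> bool" where
  "EIT \<mu> \<theta> \<longleftrightarrow> (\<exists>C::real. \<forall>n::nat.
     measure (\<mu> \<Otimes>\<^sub>M \<mu>) {(\<phi>, \<psi>) \<in> space \<mu> \<times> space \<mu>.
       infinite (range \<phi> \<inter> range \<psi>) \<or> n \<le> card (range \<phi> \<inter> range \<psi>)} \<le> C * \<theta> ^ n)"

definition admits_EIT_paths :: "('v, 'e) pre_digraph \<Rightarrow> real \<Rightarrow> bool" where
  "admits_EIT_paths G \<theta> \<longleftrightarrow> (\<exists>v\<^sub>0\<in>verts G. \<exists>\<mu>. borel_prob_on_paths G v\<^sub>0 \<mu> \<and> EIT \<mu> \<theta>)"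


section \<open>Oriented percolation\<close>

definition percolation :: "('v, 'e) pre_digraph \<Rightarrow> real \<Rightarrow> ('e \<Rightarrow> bool) measure" where
  "percolation G p = (\<Pi>\<^sub>M e\<in>arcs G. measure_pmf (bernoulli_pmf p))"

definition open_subgraph :: "('v, 'e) pre_digraph \<Rightarrow> ('e \<Rightarrow> bool) \<Rightarrow> ('v, 'e) pre_digraph" where
  "open_subgraph G \<omega> = G\<lparr>arcs := {e \<in> arcs G. \<omega> e}\<rparr>"

text \<open>Every arc and every vertex of an infinite directed path already lies on a finite initial
  segment, so it suffices to take the union of the finite directed walks.\<close>

definition open_cluster :: "('v, 'e) pre_digraph \<Rightarrow> ('e \<Rightarrow> bool) \<Rightarrow> 'v \<Rightarrow> ('v, 'e) pre_digraph" where
  "open_cluster G \<omega> v = G\<lparr>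
     verts := \<Union>{set (pre_digraph.awalk_verts G v \<pi>) | \<pi> w.
                  pre_digraph.awalk (open_subgraph G \<omega>) v \<pi> w},
     arcs := \<Union>{set \<pi> | \<pi> w. pre_digraph.awalk (open_subgraph G \<omega>) v \<pi> w}\<rparr>"


section \<open>Simple random walk and transience\<close>

text \<open>Orientations are ignored: an arc may be traversed in both directions. Parallel and
  antiparallel arcs are distinct edges, each of unit conductance. At a vertex without incident
  arcs the walk stays put.\<close>

definition incident_arcs :: "('v, 'e) pre_digraph \<Rightarrow> 'v \<Rightarrow> 'e set" where
  "incident_arcs H x = in_arcs H x \<union> out_arcs H x"

definition srw_step :: "('v, 'e) pre_digraph \<Rightarrow> 'v \<Rightarrow> 'v pmf" where
  "srw_step H x = (if incident_arcs H x = {} then return_pmf x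
     else map_pmf (\<lambda>e. if tail H e = x then head H e else tail H e) (pmf_of_set (incident_arcs H x)))"

text \<open>The joint law of \<open>[X\<^sub>0, \<dots>, X\<^sub>n]\<close> for the walk \<open>X\<close> started at \<open>X\<^sub>0 = x\<close>.\<close>

primrec srw :: "('v, 'e) pre_digraph \<Rightarrow> nat \<Rightarrow> 'v \<Rightarrow> 'v list pmf" where
  "srw H 0 x = return_pmf [x]"
| "srw H (Suc n) x = bind_pmf (srw_step H x) (\<lambda>y. map_pmf ((#) x) (srw H n y))"

text \<open>The probability that \<open>X\<^sub>k = x\<close> for some \<open>k \<ge> 1\<close>, as the increasing limit over finite time
  horizons.\<close>

definition return_prob :: "('v, 'e) pre_digraph \<Rightarrow> 'v \<Rightarrow> real" where
  "return_prob H x = (SUP n. measure_pmf.prob (srw H n x) {xs. \<exists>k\<in>{1..n}. xs ! k = x})"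

definition transient :: "('v, 'e) pre_digraph \<Rightarrow> bool" where
  "transient H \<longleftrightarrow> Digraph_Component.connected H \<and> (\<forall>x\<in>verts H. return_prob H x < 1)"

end

theory Submission
  imports Defs
begin

text \<open>
  Give each path segment from time \<open>k\<close> to time \<open>k + N\<close> its \<open>\<mu>\<close>-mass, multiplied by \<open>1 / p ^ m\<close> if all
  its \<open>m\<close> arcs are open and by \<open>0\<close> otherwise. The total weight has mean \<open>1\<close>; its variance and the mean
  energy of the resulting flow are both at most the \<open>\<mu> \<times> \<mu>\<close>-integral of \<open>M / p ^ M\<close>, where \<open>M\<close> is the
  number of common arcs of two segments. By the exponential intersection tails with \<open>\<theta> < p\<close> this
  is small uniformly in \<open>N\<close> once \<open>k\<close> is large. Hence, with probability close to \<open>1\<close> (so that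
  no zero-one law is needed), there are open flows of strength at least \<open>1/2\<close> and energy at most \<open>1\<close>
  from the finitely many possible positions at time \<open>k\<close> to far away. A fixed position \<open>v\<close> carries a
  definite share of the flow for arbitrarily large targets, so \<open>(g v)\<^sup>2\<close> is bounded by a constant times
  the Dirichlet energy of \<open>g\<close> on the cluster of \<open>v\<close>, for all finitely supported \<open>g\<close>. Applied to
  the probability of hitting \<open>x\<close> within \<open>n\<close> steps, whose energy is at most the degree of \<open>x\<close> times the
  probability of not returning to \<open>x\<close> within \<open>n + 1\<close> steps, this excludes recurrence.
\<close>

section \<open>Transience from a Dirichlet energy bound\<close>

text \<open>Only arcs across which \<open>g\<close> changes are summed, because a sum over an
  infinite set is 0 by convention. For finitely supported \<open>g\<close> on a locally finite graph
  they are finitely many, and this is the usual Dirichlet form.\<close>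

definition dirichlet_energy :: "('v, 'e) pre_digraph \<Rightarrow> ('v \<Rightarrow> real) \<Rightarrow> real" where
  "dirichlet_energy H g = (\<Sum>e | e \<in> arcs H \<and> g (tail H e) \<noteq> g (head H e). (g (tail H e) - g (head H e))\<^sup>2)"

text \<open>The finite horizon \<open>n\<close> gives this function finite support, so it can be
  tested against the energy bound. Time 0 counts, in contrast to \<open>return_prob\<close>, so the
  value at \<open>x\<close> is 1.\<close>

definition hit_prob :: "('v, 'e) pre_digraph \<Rightarrow> 'v \<Rightarrow> nat \<Rightarrow> 'v \<Rightarrow> real" where
  "hit_prob H x n y = measure_pmf.prob (srw H n y) {xs. \<exists>k\<in>{0..n}. xs ! k = x}"

lemma dirichlet_energy_nonneg: "0 \<le> dirichlet_energy H g"
  unfolding dirichlet_energy_def by (intro sum_nonneg) auto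

lemma finite_incident_arcs:
  assumes "wf_digraph H" "locally_finite H"
  shows "finite (incident_arcs H y)"
proof (cases "y \<in> verts H")
  case True
  with assms(2) show ?thesis by (simp add: locally_finite_def incident_arcs_def)
next
  case False
  with assms(1) have "incident_arcs H y = {}"
    by (auto simp: incident_arcs_def in_arcs_def out_arcs_def dest: wf_digraph.wellformed)
  then show ?thesis by simp
qed

lemma finite_dirichlet_arcs:
  assumes "wf_digraph H" "locally_finite H" "finite {y. g y \<noteq> 0}"
  shows "finite {e. e \<in> arcs H \<and> g (tail H e) \<noteq> (g (head H e) :: real)}"
proof (rule finite_subset)
  show "{e. e \<in> arcs H \<and> g (tail H e) \<noteq> g (head H e)} \<subseteq> (\<Union>y\<in>{y. g y \<noteq> 0}. incident_arcs H y)"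
    by (auto simp: incident_arcs_def) metis
  show "finite (\<Union>y\<in>{y. g y \<noteq> 0}. incident_arcs H y)"
    using assms by (auto intro: finite_incident_arcs)
qed

section \<open>First-step analysis of hitting probabilities\<close>

lemma measure_bind_pmf:
  "measure_pmf.prob (bind_pmf M f) A = measure_pmf.expectation M (\<lambda>x. measure_pmf.prob (f x) A)"
proof -
  have "ennreal (measure_pmf.prob (bind_pmf M f) A) = (\<integral>\<^sup>+x. ennreal (measure_pmf.prob (f x) A) \<partial>M)"
    by (simp flip: measure_pmf.emeasure_eq_measure)
  also have "\<dots> = ennreal (measure_pmf.expectation M (\<lambda>x. measure_pmf.prob (f x) A))"
    by (intro nn_integral_eq_integral measure_pmf.integrable_const_bound[where B=1]) auto
  finally show ?thesis by simp
qed

text \<open>Dropping the starting vertex shifts times 1 to n + 1 into times 0 to n. At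
  \<open>y = x\<close> this expresses the return probability as the mean of \<open>hit_prob\<close>
  over the neighbours of \<open>x\<close>.\<close>

lemma prob_srw_Suc:
  "measure_pmf.prob (srw H (Suc n) y) {xs. \<exists>k\<in>{1..Suc n}. xs ! k = x} =
   measure_pmf.expectation (srw_step H y) (hit_prob H x n)"
proof -
  have "(#) y -` {xs. \<exists>k\<in>{1..Suc n}. xs ! k = x} = {xs. \<exists>k\<in>{0..n}. xs ! k = x}"
  proof (intro set_eqI iffI)
    fix xs assume "xs \<in> (#) y -` {xs. \<exists>k\<in>{1..Suc n}. xs ! k = x}"
    then obtain k where "k \<in> {1..Suc n}" "(y # xs) ! k = x" by auto
    then show "xs \<in> {xs. \<exists>k\<in>{0..n}. xs ! k = x}"
      by (intro CollectI bexI[of _ "k - 1"]) (auto simp: nth_Cons')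
  next
    fix xs assume "xs \<in> {xs. \<exists>k\<in>{0..n}. xs ! k = x}"
    then obtain k where "k \<le> n" "xs ! k = x" by auto
    then show "xs \<in> (#) y -` {xs. \<exists>k\<in>{1..Suc n}. xs ! k = x}"
      by (auto intro!: bexI[of _ "Suc k"])
  qed
  then show ?thesis
    by (simp add: measure_bind_pmf hit_prob_def[abs_def])
qed

lemma hit_prob_0: "hit_prob H x 0 y = of_bool (y = x)"
  by (simp add: hit_prob_def)

lemma srw_nth_0:
  assumes "xs \<in> set_pmf (srw H n y)"
  shows "xs ! 0 = y"
  using assms by (cases n) auto

lemma hit_prob_self: "hit_prob H x n x = 1"
proof -
  have "measure_pmf.prob (srw H n x) {xs. \<exists>k\<in>{0..n}. xs ! k = x} = 1"
    by (subst measure_pmf.prob_eq_1) (auto simp: AE_measure_pmf_iff dest!: srw_nth_0)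
  then show ?thesis by (simp add: hit_prob_def)
qed

lemma hit_prob_Suc:
  assumes "y \<noteq> x"
  shows "hit_prob H x (Suc n) y = measure_pmf.expectation (srw_step H y) (hit_prob H x n)"
proof -
  have "hit_prob H x (Suc n) y = measure_pmf.prob (srw H (Suc n) y) {xs. \<exists>k\<in>{1..Suc n}. xs ! k = x}"
    unfolding hit_prob_def
  proof (intro measure_pmf.finite_measure_eq_AE)
    show "AE xs in srw H (Suc n) y. (xs \<in> {xs. \<exists>k\<in>{0..Suc n}. xs ! k = x}) =
      (xs \<in> {xs. \<exists>k\<in>{1..Suc n}. xs ! k = x})"
    proof (intro AE_pmfI)
      fix xs assume "xs \<in> set_pmf (srw H (Suc n) y)"
      then have "xs ! 0 \<noteq> x" using srw_nth_0 assms by metis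
      then show "(xs \<in> {xs. \<exists>k\<in>{0..Suc n}. xs ! k = x}) = (xs \<in> {xs. \<exists>k\<in>{1..Suc n}. xs ! k = x})"
        by (auto simp: Suc_le_eq intro!: bexI) (metis gr0I)
    qed
  qed auto
  then show ?thesis by (simp only: prob_srw_Suc)
qed

lemma expectation_srw_step:
  assumes "finite (incident_arcs H y)"
  shows "measure_pmf.expectation (srw_step H y) g =
    (if incident_arcs H y = {} then g y
     else (\<Sum>e\<in>incident_arcs H y. g (if tail H e = y then head H e else tail H e))
       / card (incident_arcs H y))"
  using assms by (simp add: srw_step_def integral_pmf_of_set)

lemma hit_prob_nonneg: "0 \<le> hit_prob H x n y"
  by (simp add: hit_prob_def)

text \<open>The laws for \<open>n\<close> and \<open>Suc n\<close> steps live on lists of different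
  lengths, so the events are not compared directly; the averaging recursion off \<open>x\<close>
  carries the inequality from one horizon to the next.\<close>

lemma hit_prob_mono:
  assumes "\<And>y. finite (incident_arcs H y)"
  shows "hit_prob H x n y \<le> hit_prob H x (Suc n) y"
proof (induction n arbitrary: y)
  case 0
  show ?case by (cases "y = x") (simp_all add: hit_prob_0 hit_prob_self hit_prob_nonneg)
next
  case (Suc n)
  show ?case
  proof (cases "y = x")
    case False
    then show ?thesis
      using Suc by (auto simp: hit_prob_Suc expectation_srw_step[OF assms] intro!: divide_right_mono sum_mono)
  qed (simp add: hit_prob_self)
qed

lemma hit_prob_support:
  assumes "wf_digraph H" "locally_finite H" "x \<in> verts H"
  shows "finite {y. hit_prob H x n y \<noteq> 0} \<and> {y. hit_prob H x n y \<noteq> 0} \<subseteq> verts H"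
proof (induction n)
  case 0
  show ?case using assms(3) by (auto simp: hit_prob_0)
next
  case (Suc n)
  let ?S = "{y. hit_prob H x n y \<noteq> 0}"
  let ?T = "insert x (?S \<union> (\<Union>y\<in>?S. head H ` incident_arcs H y \<union> tail H ` incident_arcs H y))"
  have "y \<in> ?T" if y: "hit_prob H x (Suc n) y \<noteq> 0" for y
  proof (rule ccontr)
    assume n: "y \<notin> ?T"
    have "hit_prob H x n (if tail H e = y then head H e else tail H e) = 0" if e: "e \<in> incident_arcs H y" for e
    proof (rule ccontr)
      let ?z = "if tail H e = y then head H e else tail H e"
      assume z: "hit_prob H x n ?z \<noteq> 0"
      have "e \<in> incident_arcs H ?z" using e by (auto simp: incident_arcs_def)
      moreover have "y = head H e \<or> y = tail H e" using e by (auto simp: incident_arcs_def)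
      ultimately have "y \<in> (\<Union>y\<in>?S. head H ` incident_arcs H y \<union> tail H ` incident_arcs H y)"
        using z by blast
      with n show False by blast
    qed
    with n have "hit_prob H x (Suc n) y = 0"
      by (simp add: hit_prob_Suc expectation_srw_step[OF finite_incident_arcs[OF assms(1,2)]])
    with y show False by simp
  qed
  then have "{y. hit_prob H x (Suc n) y \<noteq> 0} \<subseteq> ?T" by auto
  moreover have "finite ?T" using Suc finite_incident_arcs[OF assms(1,2)] by auto
  moreover have "?T \<subseteq> verts H"
    using Suc assms by (auto simp: incident_arcs_def wf_digraph.head_in_verts wf_digraph.tail_in_verts)
  ultimately show ?case using finite_subset by blast
qed

text \<open>Discrete Green formula. An arc with ends a and b contributes g a (g a - g b) from one
  end and g b (g b - g a) from the other, which add up to the square; a loop contributes 0 on both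
  sides.\<close>

lemma dirichlet_energy_by_parts:
  fixes H :: "('v, 'e) pre_digraph" and g :: "'v \<Rightarrow> real"
  assumes "wf_digraph H" "locally_finite H" and S: "finite S" "{y. g y \<noteq> 0} \<subseteq> S"
  shows "dirichlet_energy H g =
    (\<Sum>y\<in>S. g y * (\<Sum>e\<in>incident_arcs H y. g y - g (if tail H e = y then head H e else tail H e)))"
proof -
  let ?nb = "\<lambda>y e. if tail H e = y then head H e else tail H e"
  define A where "A = (\<Union>y\<in>S. incident_arcs H y)"
  have fA: "finite A" unfolding A_def using S finite_incident_arcs[OF assms(1,2)] by auto
  have inner: "(\<Sum>y\<in>S. if e \<in> incident_arcs H y then g y * (g y - g (?nb y e)) else 0)
      = (g (tail H e) - g (head H e))\<^sup>2" if e: "e \<in> A" for e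
  proof -
    let ?f = "\<lambda>y. if e \<in> incident_arcs H y then g y * (g y - g (?nb y e)) else 0"
    have ea: "e \<in> arcs H" using e by (auto simp: A_def incident_arcs_def)
    \<comment> \<open>An end of \<open>e\<close> outside \<open>S\<close> may be added freely, since
      \<open>g\<close> vanishes there.\<close>
    have "sum ?f S = sum ?f (S \<union> {tail H e, head H e})"
      using S by (intro sum.mono_neutral_left) auto
    also have "\<dots> = sum ?f {tail H e, head H e}"
      using S ea by (intro sum.mono_neutral_right) (auto simp: incident_arcs_def)
    also have "\<dots> = (g (tail H e) - g (head H e))\<^sup>2"
      using ea by (cases "tail H e = head H e") (auto simp: incident_arcs_def power2_eq_square algebra_simps)
    finally show ?thesis .
  qed
  have "(\<Sum>y\<in>S. g y * (\<Sum>e\<in>incident_arcs H y. g y - g (?nb y e)))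
      = (\<Sum>y\<in>S. \<Sum>e\<in>A. if e \<in> incident_arcs H y then g y * (g y - g (?nb y e)) else 0)"
  proof (intro sum.cong refl)
    fix y assume "y \<in> S"
    then have "A \<inter> incident_arcs H y = incident_arcs H y" by (auto simp: A_def)
    then show "g y * (\<Sum>e\<in>incident_arcs H y. g y - g (?nb y e))
        = (\<Sum>e\<in>A. if e \<in> incident_arcs H y then g y * (g y - g (?nb y e)) else 0)"
      using sum.inter_restrict[OF fA, of "\<lambda>e. g y * (g y - g (?nb y e))" "incident_arcs H y"]
      by (simp add: sum_distrib_left)
  qed
  also have "\<dots> = (\<Sum>e\<in>A. (g (tail H e) - g (head H e))\<^sup>2)"
    by (subst sum.swap) (simp only: inner cong: sum.cong)
  also have "\<dots> = dirichlet_energy H g"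
    unfolding dirichlet_energy_def
  proof (intro sum.mono_neutral_right fA)
    show "{e. e \<in> arcs H \<and> g (tail H e) \<noteq> g (head H e)} \<subseteq> A"
    proof (rule subsetI)
      fix e assume e: "e \<in> {e. e \<in> arcs H \<and> g (tail H e) \<noteq> g (head H e)}"
      then have "g (tail H e) \<noteq> 0 \<or> g (head H e) \<noteq> 0" by auto
      then have "tail H e \<in> S \<or> head H e \<in> S" using S(2) by blast
      with e show "e \<in> A" by (auto simp: A_def incident_arcs_def)
    qed
  qed (auto simp: A_def incident_arcs_def)
  finally show ?thesis by simp
qed

text \<open>After summation by parts, a vertex y other than \<open>x\<close> contributes its degree
  times h y times the difference of the hitting probabilities for horizons n and n + 1, which is at
  most 0. Only the term at \<open>x\<close> survives, where h is 1.\<close>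

lemma dirichlet_energy_hit_prob:
  assumes "wf_digraph H" "locally_finite H" "x \<in> verts H"
  shows "dirichlet_energy H (hit_prob H x n) \<le> card (incident_arcs H x) *
    (1 - measure_pmf.prob (srw H (Suc n) x) {xs. \<exists>k\<in>{1..Suc n}. xs ! k = x})"
proof -
  note fin = finite_incident_arcs[OF assms(1,2)]
  let ?h = "hit_prob H x n"
  let ?S = "insert x {y. ?h y \<noteq> 0}"
  let ?nb = "\<lambda>y e. if tail H e = y then head H e else tail H e"
  have fS: "finite ?S" using hit_prob_support[OF assms] by auto
  have lap: "(\<Sum>e\<in>incident_arcs H y. ?h y - ?h (?nb y e))
      = card (incident_arcs H y) * (?h y - measure_pmf.expectation (srw_step H y) ?h)" for y
    using fin[of y] by (auto simp: expectation_srw_step sum_subtractf field_simps)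
  have "dirichlet_energy H ?h = (\<Sum>y\<in>?S. ?h y * (\<Sum>e\<in>incident_arcs H y. ?h y - ?h (?nb y e)))"
    by (intro dirichlet_energy_by_parts assms fS) auto
  also have "\<dots> \<le> (\<Sum>y\<in>?S. if y = x then card (incident_arcs H x) *
      (1 - measure_pmf.expectation (srw_step H x) ?h) else 0)"
  proof (intro sum_mono)
    fix y
    show "?h y * (\<Sum>e\<in>incident_arcs H y. ?h y - ?h (?nb y e)) \<le> (if y = x then card (incident_arcs H x) *
      (1 - measure_pmf.expectation (srw_step H x) ?h) else 0)"
    proof (cases "y = x")
      case True
      then show ?thesis using lap[of x] by (simp add: hit_prob_self)
    next
      case False
      have "?h y - hit_prob H x (Suc n) y \<le> 0" using hit_prob_mono[of H x n y] fin by simp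
      then show ?thesis using False
        by (auto simp: lap simp flip: hit_prob_Suc intro!: mult_nonneg_nonpos hit_prob_nonneg)
    qed
  qed
  also have "\<dots> = card (incident_arcs H x) * (1 - measure_pmf.expectation (srw_step H x) ?h)"
    using fS by (subst sum.delta) auto
  finally show ?thesis by (simp only: prob_srw_Suc)
qed

text \<open>Each edge of a path from \<open>v\<close> to \<open>x\<close> changes \<open>g\<close>
  by at most the square root of the energy, so the length of the path serves as \<open>L\<close>,
  uniformly in \<open>g\<close>.\<close>

lemma diff_le_sqrt_dirichlet_energy:
  fixes H :: "('v, 'e) pre_digraph"
  assumes "wf_digraph H" "locally_finite H"
    and "(v, x) \<in> {(a, b). \<exists>e\<in>arcs H. (a, b) = (tail H e, head H e) \<or> (b, a) = (tail H e, head H e)}\<^sup>*"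
  shows "\<exists>L\<ge>0. \<forall>g :: 'v \<Rightarrow> real. finite {y. g y \<noteq> 0} \<longrightarrow> \<bar>g v - g x\<bar> \<le> L * sqrt (dirichlet_energy H g)"
  using assms(3)
proof (induction rule: rtrancl_induct)
  case base
  then show ?case by (intro exI[of _ 0]) auto
next
  case (step y z)
  then obtain L where L: "L \<ge> 0" "\<And>g :: 'v \<Rightarrow> real. finite {y. g y \<noteq> 0} \<Longrightarrow> \<bar>g v - g y\<bar> \<le> L * sqrt (dirichlet_energy H g)"
    by blast
  from step obtain e where e: "e \<in> arcs H" "(y, z) = (tail H e, head H e) \<or> (z, y) = (tail H e, head H e)"
    by blast
  show ?case
  proof (intro exI[of _ "L + 1"] conjI allI impI)
    fix g :: "'v \<Rightarrow> real" assume g: "finite {y. g y \<noteq> 0}"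
    have "\<bar>g y - g z\<bar> \<le> sqrt (dirichlet_energy H g)"
    proof (cases "g (tail H e) = g (head H e)")
      case True
      with e show ?thesis by (auto simp: dirichlet_energy_nonneg)
    next
      case False
      have "(g (tail H e) - g (head H e))\<^sup>2 \<le> dirichlet_energy H g"
        unfolding dirichlet_energy_def
        by (rule member_le_sum[where f="\<lambda>e. (g (tail H e) - g (head H e))\<^sup>2"])
          (use finite_dirichlet_arcs[OF assms(1,2) g] e False in auto)
      then have "\<bar>g (tail H e) - g (head H e)\<bar> \<le> sqrt (dirichlet_energy H g)"
        by (simp add: real_le_rsqrt)
      with e show ?thesis by (auto simp: abs_minus_commute)
    qed
    with L(2)[OF g] show "\<bar>g v - g z\<bar> \<le> (L + 1) * sqrt (dirichlet_energy H g)"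
      by (simp add: algebra_simps)
  qed (use L in auto)
qed

text \<open>With h the hitting probability of \<open>x\<close>, 1 = h x is at most h v plus the
  oscillation of h between \<open>v\<close> and \<open>x\<close>, and both are bounded by multiples
  of the root of the energy. The energy thus stays away from 0 for all horizons, and so does the
  probability of not returning.\<close>

lemma return_prob_less_1:
  fixes H :: "('v, 'e) pre_digraph"
  assumes "wf_digraph H" "locally_finite H" "x \<in> verts H"
    and conn: "(v, x) \<in> {(a, b). \<exists>e\<in>arcs H. (a, b) = (tail H e, head H e) \<or> (b, a) = (tail H e, head H e)}\<^sup>*"
    and K: "\<And>g. finite {y. g y \<noteq> 0} \<Longrightarrow> {y. g y \<noteq> 0} \<subseteq> verts H \<Longrightarrow> (g v)\<^sup>2 \<le> K * dirichlet_energy H g"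
  shows "return_prob H x < 1"
proof -
  obtain L where L: "L \<ge> 0" "\<And>g :: 'v \<Rightarrow> real. finite {y. g y \<noteq> 0} \<Longrightarrow> \<bar>g v - g x\<bar> \<le> L * sqrt (dirichlet_energy H g)"
    using diff_le_sqrt_dirichlet_energy[OF assms(1,2) conn] by blast
  let ?r = "\<lambda>n. measure_pmf.prob (srw H n x) {xs. \<exists>k\<in>{1..n}. xs ! k = x}"
  define M where "M = (sqrt \<bar>K\<bar> + L)\<^sup>2 * card (incident_arcs H x)"
  have M: "1 \<le> M * (1 - ?r (Suc n))" for n
  proof -
    let ?h = "hit_prob H x n" and ?D = "dirichlet_energy H (hit_prob H x n)"
    have supp: "finite {y. ?h y \<noteq> 0}" "{y. ?h y \<noteq> 0} \<subseteq> verts H"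
      using hit_prob_support[OF assms(1-3)] by auto
    have "(?h v)\<^sup>2 \<le> K * ?D" using K[OF supp] .
    also have "\<dots> \<le> \<bar>K\<bar> * ?D" by (intro mult_right_mono dirichlet_energy_nonneg) auto
    finally have "?h v \<le> sqrt (\<bar>K\<bar> * ?D)" by (rule real_le_rsqrt)
    moreover have "\<bar>?h v - 1\<bar> \<le> L * sqrt ?D" using L(2)[OF supp(1)] by (simp add: hit_prob_self)
    ultimately have "1 \<le> (sqrt \<bar>K\<bar> + L) * sqrt ?D" by (simp add: real_sqrt_mult algebra_simps)
    then have "1\<^sup>2 \<le> ((sqrt \<bar>K\<bar> + L) * sqrt ?D)\<^sup>2" by (intro power_mono) auto
    also have "\<dots> = (sqrt \<bar>K\<bar> + L)\<^sup>2 * ?D" by (simp add: power_mult_distrib dirichlet_energy_nonneg)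
    also have "\<dots> \<le> (sqrt \<bar>K\<bar> + L)\<^sup>2 * (card (incident_arcs H x) * (1 - ?r (Suc n)))"
      by (intro mult_left_mono dirichlet_energy_hit_prob assms) auto
    finally show ?thesis by (simp add: M_def mult.assoc)
  qed
  have r1: "?r n \<le> 1" for n by simp
  have "M > 0"
    using M[of 0] r1[of "Suc 0"] by (smt (verit) mult_nonpos_nonneg)
  \<comment> \<open>This covers horizon 0, where the return event is empty and 1 - 1 / M must still
    be nonnegative.\<close>
  have "M \<ge> 1"
  proof -
    have "M * (1 - ?r (Suc 0)) \<le> M * 1" using \<open>M > 0\<close> by (intro mult_left_mono) auto
    with M[of 0] show ?thesis by linarith
  qed
  have "return_prob H x \<le> 1 - 1 / M"
    unfolding return_prob_def
  proof (rule cSUP_least)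
    fix n
    show "?r n \<le> 1 - 1 / M"
    proof (cases n)
      case 0
      then show ?thesis using \<open>M \<ge> 1\<close> by simp
    next
      case (Suc m)
      show ?thesis unfolding Suc using M[of m] \<open>M > 0\<close> by (simp add: field_simps)
    qed
  qed simp
  also have "\<dots> < 1" using \<open>M > 0\<close> by simp
  finally show ?thesis .
qed

section \<open>Flows on open clusters\<close>

lemma open_subgraph_simps [simp]:
  "verts (open_subgraph G \<omega>) = verts G" "arcs (open_subgraph G \<omega>) = {e \<in> arcs G. \<omega> e}"
  "tail (open_subgraph G \<omega>) = tail G" "head (open_subgraph G \<omega>) = head G"
  by (simp_all add: open_subgraph_def)

lemma tail_head_open_cluster [simp]:
  "tail (open_cluster G \<omega> v) = tail G" "head (open_cluster G \<omega> v) = head G"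
  by (simp_all add: open_cluster_def)

lemma wf_digraph_open_subgraph: "wf_digraph G \<Longrightarrow> wf_digraph (open_subgraph G \<omega>)"
  by unfold_locales (auto dest: wf_digraph.wellformed)

lemma verts_open_cluster:
  assumes "wf_digraph G"
  shows "verts (open_cluster G \<omega> v) = {x. v \<rightarrow>\<^sup>*\<^bsub>open_subgraph G \<omega>\<^esub> x}"
proof -
  interpret O: wf_digraph "open_subgraph G \<omega>" using assms by (rule wf_digraph_open_subgraph)
  \<comment> \<open>The vertex list of a walk depends only on \<open>tail\<close> and
    \<open>head\<close>, which \<open>G\<close> shares with its open subgraph.\<close>
  have *: "pre_digraph.awalk_verts G = O.awalk_verts"
    by (rule compatible_awalk_verts) (simp add: compatible_def)
  have "x \<in> verts (open_cluster G \<omega> v) \<longleftrightarrow> (\<exists>\<pi> w. O.awalk v \<pi> w \<and> x \<in> set (O.awalk_verts v \<pi>))" for x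
    by (auto simp: open_cluster_def *)
  moreover have "(\<exists>\<pi> w. O.awalk v \<pi> w \<and> x \<in> set (O.awalk_verts v \<pi>)) \<longleftrightarrow> v \<rightarrow>\<^sup>*\<^bsub>open_subgraph G \<omega>\<^esub> x" for x
  proof
    assume "\<exists>\<pi> w. O.awalk v \<pi> w \<and> x \<in> set (O.awalk_verts v \<pi>)"
    then show "v \<rightarrow>\<^sup>*\<^bsub>open_subgraph G \<omega>\<^esub> x" using O.awalk_verts_reachable_from by blast
  next
    assume "v \<rightarrow>\<^sup>*\<^bsub>open_subgraph G \<omega>\<^esub> x"
    then obtain \<pi> where "O.awalk v \<pi> x" using O.reachable_awalk by blast
    moreover from this have "x = last (O.awalk_verts v \<pi>)" by auto
    then have "x \<in> set (O.awalk_verts v \<pi>)" using last_in_set O.awalk_verts_non_Nil by blast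
    ultimately show "\<exists>\<pi> w. O.awalk v \<pi> w \<and> x \<in> set (O.awalk_verts v \<pi>)" by blast
  qed
  ultimately show ?thesis by auto
qed

lemma arcs_open_cluster:
  assumes "wf_digraph G"
  shows "arcs (open_cluster G \<omega> v) = {e \<in> arcs G. \<omega> e \<and> v \<rightarrow>\<^sup>*\<^bsub>open_subgraph G \<omega>\<^esub> tail G e}"
proof -
  interpret O: wf_digraph "open_subgraph G \<omega>" using assms by (rule wf_digraph_open_subgraph)
  have *: "e \<in> arcs (open_cluster G \<omega> v) \<longleftrightarrow> (\<exists>\<pi> w. O.awalk v \<pi> w \<and> e \<in> set \<pi>)" for e
    by (auto simp: open_cluster_def)
  show ?thesis
  proof (intro set_eqI iffI)
    fix e assume "e \<in> arcs (open_cluster G \<omega> v)"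
    then obtain \<pi> w where \<pi>: "O.awalk v \<pi> w" "e \<in> set \<pi>" using * by blast
    then have "tail G e \<in> set (O.awalk_verts v \<pi>)" by (auto simp: O.awalk_verts_conv)
    with \<pi> show "e \<in> {e \<in> arcs G. \<omega> e \<and> v \<rightarrow>\<^sup>*\<^bsub>open_subgraph G \<omega>\<^esub> tail G e}"
      using O.awalk_verts_reachable_from by (auto simp: O.awalk_def)
  next
    fix e assume e: "e \<in> {e \<in> arcs G. \<omega> e \<and> v \<rightarrow>\<^sup>*\<^bsub>open_subgraph G \<omega>\<^esub> tail G e}"
    then obtain \<pi> where "O.awalk v \<pi> (tail G e)" using O.reachable_awalk by auto
    with e have "O.awalk v (\<pi> @ [e]) (head G e)"
      using O.arc_implies_awalk[of e] by (intro O.awalk_appendI) auto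
    moreover have "e \<in> set (\<pi> @ [e])" by simp
    ultimately show "e \<in> arcs (open_cluster G \<omega> v)" using * by blast
  qed
qed

lemma wf_digraph_open_cluster:
  assumes "wf_digraph G"
  shows "wf_digraph (open_cluster G \<omega> v)"
proof
  interpret O: wf_digraph "open_subgraph G \<omega>" using assms by (rule wf_digraph_open_subgraph)
  fix e assume e: "e \<in> arcs (open_cluster G \<omega> v)"
  then have "tail G e \<rightarrow>\<^bsub>open_subgraph G \<omega>\<^esub> head G e"
    using O.in_arcs_imp_in_arcs_ends[of e] by (simp add: arcs_open_cluster[OF assms])
  moreover have "v \<rightarrow>\<^sup>*\<^bsub>open_subgraph G \<omega>\<^esub> tail G e" using e by (simp add: arcs_open_cluster[OF assms])
  ultimately have "v \<rightarrow>\<^sup>*\<^bsub>open_subgraph G \<omega>\<^esub> head G e" using O.reachable_adj_trans by blast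
  then show "head (open_cluster G \<omega> v) e \<in> verts (open_cluster G \<omega> v)"
    by (simp add: verts_open_cluster[OF assms])
  show "tail (open_cluster G \<omega> v) e \<in> verts (open_cluster G \<omega> v)"
    using e by (simp add: arcs_open_cluster[OF assms] verts_open_cluster[OF assms])
qed

lemma locally_finite_open_cluster:
  assumes "wf_digraph G" "locally_finite G"
  shows "locally_finite (open_cluster G \<omega> v)"
proof -
  interpret O: wf_digraph "open_subgraph G \<omega>" using assms by (intro wf_digraph_open_subgraph)
  have "in_arcs (open_cluster G \<omega> v) x \<subseteq> in_arcs G x" "out_arcs (open_cluster G \<omega> v) x \<subseteq> out_arcs G x" for x
    by (auto simp: arcs_open_cluster[OF assms(1)])
  moreover have "verts (open_cluster G \<omega> v) \<subseteq> verts G"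
    using O.reachable_in_verts by (auto simp: verts_open_cluster[OF assms(1)])
  ultimately show ?thesis
    using assms(2) unfolding locally_finite_def by (meson finite_subset subsetD)
qed

lemma open_cluster_reachable:
  assumes "wf_digraph G" "x \<in> verts (open_cluster G \<omega> v)"
  shows "v \<rightarrow>\<^sup>*\<^bsub>open_cluster G \<omega> v\<^esub> x"
proof -
  let ?H = "open_cluster G \<omega> v"
  interpret O: wf_digraph "open_subgraph G \<omega>" using assms by (intro wf_digraph_open_subgraph)
  interpret H: wf_digraph ?H using assms by (intro wf_digraph_open_cluster)
  have "v \<rightarrow>\<^sup>*\<^bsub>open_subgraph G \<omega>\<^esub> x" using assms by (simp add: verts_open_cluster)
  then show ?thesis
  proof (induction rule: O.reachable_induct)
    case base
    then show ?case by (intro H.reachable_refl) (simp add: verts_open_cluster[OF assms(1)])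
  next
    case (step x y)
    then obtain e where e: "e \<in> arcs G" "\<omega> e" "tail G e = x" "head G e = y" by (auto elim!: reachableE)
    with step have "x \<rightarrow>\<^bsub>?H\<^esub> y"
      using H.in_arcs_imp_in_arcs_ends[of e] by (simp add: arcs_open_cluster[OF assms(1)])
    with step show ?case using H.reachable_adj_trans by blast
  qed
qed

lemma connected_open_cluster:
  assumes "wf_digraph G" "v \<in> verts G"
  shows "Digraph_Component.connected (open_cluster G \<omega> v)"
proof -
  let ?H = "open_cluster G \<omega> v"
  interpret O: wf_digraph "open_subgraph G \<omega>" using assms by (intro wf_digraph_open_subgraph)
  interpret H: wf_digraph ?H using assms by (intro wf_digraph_open_cluster)
  interpret S: pair_wf_digraph "mk_symmetric ?H" ..
  have r: "v \<rightarrow>\<^sup>*\<^bsub>mk_symmetric ?H\<^esub> x" if "x \<in> verts ?H" for x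
    by (rule H.reachable_mk_symmetricI[OF open_cluster_reachable[OF assms(1) that]])
  have "x \<rightarrow>\<^sup>*\<^bsub>mk_symmetric ?H\<^esub> y" if "x \<in> verts ?H" "y \<in> verts ?H" for x y
    by (rule S.reachable_trans[OF symmetric_reachable[OF symmetric_mk_symmetric r[OF that(1)]] r[OF that(2)]])
  moreover have "v \<in> verts ?H" using assms by (auto simp: verts_open_cluster)
  ultimately show ?thesis by (auto simp: connected_def strongly_connected_def)
qed

text \<open>By the Dirichlet principle the hypothesis says that the effective resistance from
  \<open>v\<close> to infinity in the cluster is at most \<open>K\<close>. Connectedness carries the
  conclusion from \<open>v\<close> to every vertex.\<close>

lemma transient_open_cluster:
  fixes G :: "('v, 'e) pre_digraph"
  assumes "wf_digraph G" "locally_finite G" "v \<in> verts G"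
    and K: "\<And>g. finite {y. g y \<noteq> 0} \<Longrightarrow> {y. g y \<noteq> 0} \<subseteq> verts (open_cluster G \<omega> v) \<Longrightarrow>
      (g v)\<^sup>2 \<le> K * dirichlet_energy (open_cluster G \<omega> v) g"
  shows "transient (open_cluster G \<omega> v)"
  unfolding transient_def
proof (intro conjI ballI)
  let ?H = "open_cluster G \<omega> v"
  show "Digraph_Component.connected ?H" using assms by (intro connected_open_cluster)
  fix x assume x: "x \<in> verts ?H"
  let ?R = "{(a, b). \<exists>e\<in>arcs ?H. (a, b) = (tail ?H e, head ?H e) \<or> (b, a) = (tail ?H e, head ?H e)}"
  have "arcs_ends ?H \<subseteq> ?R" by (auto simp: arcs_ends_conv)
  from rtrancl_mono[OF this] reachable_rtranclI[OF open_cluster_reachable[OF assms(1) x]]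
  have "(v, x) \<in> ?R\<^sup>*" by (rule subsetD)
  then show "return_prob ?H x < 1"
    using assms x by (intro return_prob_less_1[where K=K and v=v] wf_digraph_open_cluster locally_finite_open_cluster)
qed

section \<open>Pairing flows with gradients\<close>

lemma (in pre_digraph) cas_telescope:
  fixes g :: "'a \<Rightarrow> real"
  assumes "cas u p w"
  shows "g u - g w = (\<Sum>e\<leftarrow>p. g (tail G e) - g (head G e))"
  using assms
proof (induction p arbitrary: u)
  case (Cons e p)
  then have "g (head G e) - g w = (\<Sum>e\<leftarrow>p. g (tail G e) - g (head G e))" by auto
  with Cons.prems show ?case by auto
qed simp

text \<open>Sending an amount \<open>a i\<close> along each trail \<open>q i\<close> gives a flow out of \<open>v\<close> whose energy is the
  double sum; pair it with the gradient of \<open>g\<close> and apply Cauchy--Schwarz.\<close>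

lemma flow_le_dirichlet_energy:
  fixes G :: "('v, 'e) pre_digraph" and a :: "'i \<Rightarrow> real" and g :: "'v \<Rightarrow> real"
  assumes G: "wf_digraph G" "locally_finite G"
    and I: "finite I"
    and q: "\<And>i. i \<in> I \<Longrightarrow> a i \<noteq> 0 \<Longrightarrow> pre_digraph.trail (open_subgraph G \<omega>) v (q i) (w i)"
    and g: "finite {y. g y \<noteq> 0}" "\<And>i. i \<in> I \<Longrightarrow> a i \<noteq> 0 \<Longrightarrow> g (w i) = 0"
    and a: "\<And>i. i \<in> I \<Longrightarrow> a i \<ge> 0"
  shows "((\<Sum>i\<in>I. a i) * g v)\<^sup>2 \<le> (\<Sum>i\<in>I. \<Sum>j\<in>I. a i * a j * card (set (q i) \<inter> set (q j))) *
    dirichlet_energy (open_cluster G \<omega> v) g"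
proof -
  let ?H = "open_cluster G \<omega> v"
  interpret O: wf_digraph "open_subgraph G \<omega>" using G by (intro wf_digraph_open_subgraph)
  define E where "E = {e. e \<in> arcs ?H \<and> g (tail ?H e) \<noteq> g (head ?H e)}"
  define d where "d e = g (tail G e) - g (head G e)" for e
  define f where "f e = (\<Sum>i\<in>I. a i * of_bool (e \<in> set (q i)))" for e
  have fE: "finite E"
    unfolding E_def by (intro finite_dirichlet_arcs wf_digraph_open_cluster locally_finite_open_cluster G g)
  \<comment> \<open>The gradient telescopes along the trail to \<open>g v\<close>, since
    \<open>g\<close> vanishes at its end. The arcs of a trail are distinct, so the sum over the list
    is a sum over a set, and arcs outside \<open>E\<close> have zero gradient.\<close>
  have path: "a i * g v = (\<Sum>e\<in>E. a i * of_bool (e \<in> set (q i)) * d e)" if i: "i \<in> I" for i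
  proof (cases "a i = 0")
    case False
    have aw: "O.awalk v (q i) (w i)" and dist: "distinct (q i)" using q[OF i False] by (auto simp: O.trail_def)
    then have cas: "O.cas v (q i) (w i)" by (simp add: O.awalk_def)
    have "g v = (\<Sum>e\<leftarrow>q i. d e)"
      using O.cas_telescope[OF cas, of g] g(2)[OF i False] by (simp add: d_def)
    also have "\<dots> = (\<Sum>e\<in>set (q i). d e)" using dist by (simp add: sum_list_distinct_conv_sum_set)
    also have "\<dots> = (\<Sum>e\<in>E \<inter> set (q i). d e)"
    proof (intro sum.mono_neutral_right ballI)
      have "set (q i) \<subseteq> arcs ?H" using aw by (auto simp: open_cluster_def)
      then show "d e = 0" if "e \<in> set (q i) - E \<inter> set (q i)" for e
        using that by (auto simp: E_def d_def)
    qed auto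
    also have "\<dots> = (\<Sum>e\<in>E. of_bool (e \<in> set (q i)) * d e)"
      using fE by (simp add: sum.inter_restrict of_bool_def if_distrib[of "\<lambda>x. x * _"] cong: if_cong)
    finally show ?thesis by (simp add: sum_distrib_left mult.assoc)
  qed simp
  have "(\<Sum>i\<in>I. a i) * g v = (\<Sum>e\<in>E. f e * d e)"
    by (simp add: sum_distrib_right path f_def) (rule sum.swap)
  then have "((\<Sum>i\<in>I. a i) * g v)\<^sup>2 \<le> (\<Sum>e\<in>E. (f e)\<^sup>2) * (\<Sum>e\<in>E. (d e)\<^sup>2)"
    by (simp add: Cauchy_Schwarz_ineq_sum)
  also have "(\<Sum>e\<in>E. (d e)\<^sup>2) = dirichlet_energy ?H g"
    by (simp add: dirichlet_energy_def E_def d_def)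
  also have "(\<Sum>e\<in>E. (f e)\<^sup>2) = (\<Sum>i\<in>I. \<Sum>j\<in>I. a i * a j * card (E \<inter> (set (q i) \<inter> set (q j))))"
  proof -
    have "(\<Sum>e\<in>E. (f e)\<^sup>2) = (\<Sum>e\<in>E. \<Sum>i\<in>I. \<Sum>j\<in>I. a i * a j * of_bool (e \<in> set (q i) \<inter> set (q j)))"
      by (simp add: f_def power2_eq_square sum_product of_bool_conj mult_ac)
    also have "\<dots> = (\<Sum>i\<in>I. \<Sum>j\<in>I. \<Sum>e\<in>E. a i * a j * of_bool (e \<in> set (q i) \<inter> set (q j)))"
      by (subst sum.swap, intro sum.cong refl, rule sum.swap)
    also have "\<dots> = (\<Sum>i\<in>I. \<Sum>j\<in>I. a i * a j * card (E \<inter> (set (q i) \<inter> set (q j))))"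
      using fE by (simp add: sum_distrib_left[symmetric] of_bool_def sum.If_cases Int_def conj_ac)
    finally show ?thesis .
  qed
  also have "\<dots> * dirichlet_energy ?H g \<le> (\<Sum>i\<in>I. \<Sum>j\<in>I. a i * a j * card (set (q i) \<inter> set (q j))) * dirichlet_energy ?H g"
    using a by (intro mult_right_mono sum_mono mult_left_mono dirichlet_energy_nonneg)
      (auto intro!: card_mono)
  finally show ?thesis by simp
qed

section \<open>Second moments of open path weights\<close>

lemma prob_space_percolation: "prob_space (percolation G p)"
  unfolding percolation_def by (intro prob_space_PiM measure_pmf.prob_space_axioms)

lemma all_open_measurable [measurable]:
  assumes "finite R" "R \<subseteq> arcs G"
  shows "Measurable.pred (percolation G p) (\<lambda>\<omega>. \<forall>e\<in>R. \<omega> e)"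
proof (rule pred_intros_finite)
  fix e assume "e \<in> R"
  with assms have "(\<lambda>\<omega>. \<omega> e) \<in> measurable (percolation G p) (measure_pmf (bernoulli_pmf p))"
    unfolding percolation_def by (intro measurable_component_singleton) auto
  then show "Measurable.pred (percolation G p) (\<lambda>\<omega>. \<omega> e)" by simp
qed (rule assms)

lemma prob_all_open:
  assumes "finite R" "R \<subseteq> arcs G" "0 \<le> p" "p \<le> 1"
  shows "measure (percolation G p) {\<omega> \<in> space (percolation G p). \<forall>e\<in>R. \<omega> e} = p ^ card R"
proof -
  interpret product_prob_space "\<lambda>_. measure_pmf (bernoulli_pmf p)" "arcs G"
    by (simp add: product_prob_space_def product_sigma_finite_def product_prob_space_axioms_def
        measure_pmf.sigma_finite_measure_axioms measure_pmf.prob_space_axioms)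
  have "emeasure (percolation G p) {\<omega> \<in> space (percolation G p). \<forall>e\<in>R. \<omega> e \<in> {True}}
      = (\<Prod>e\<in>R. emeasure (measure_pmf (bernoulli_pmf p)) {True})"
    unfolding percolation_def using assms by (intro emeasure_PiM_Collect) auto
  also have "\<dots> = ennreal (p ^ card R)"
    using assms by (simp add: emeasure_pmf_single ennreal_power)
  finally show ?thesis using assms by (simp add: measure_def)
qed

text \<open>For \<open>p > 0\<close> this is the density, relative to percolation, of percolation
  conditioned on \<open>R\<close> being open; in particular its mean is 1.\<close>

definition open_weight :: "real \<Rightarrow> 'e set \<Rightarrow> ('e \<Rightarrow> bool) \<Rightarrow> real" where
  "open_weight p R \<omega> = of_bool (\<forall>e\<in>R. \<omega> e) / p ^ card R"

lemma open_weight_nonneg: "0 < p \<Longrightarrow> 0 \<le> open_weight p R \<omega>"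
  by (simp add: open_weight_def)

context
  fixes G :: "('v, 'e) pre_digraph" and p :: real
  assumes p: "0 < p" "p < 1"
begin

interpretation prob_space "percolation G p" by (rule prob_space_percolation)

lemma open_weight_measurable [measurable]:
  "finite R \<Longrightarrow> R \<subseteq> arcs G \<Longrightarrow> open_weight p R \<in> borel_measurable (percolation G p)"
  unfolding open_weight_def[abs_def] by measurable

lemma open_weight_le: "open_weight p R \<omega> \<le> 1 / p ^ card R"
  using p by (simp add: open_weight_def)

lemma integrable_open_weight:
  assumes "finite R" "R \<subseteq> arcs G"
  shows "integrable (percolation G p) (open_weight p R)"
proof (rule integrable_const_bound[where B="1 / p ^ card R"])
  show "AE \<omega> in percolation G p. norm (open_weight p R \<omega>) \<le> 1 / p ^ card R"
  proof (rule AE_I2)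
    fix \<omega>
    show "norm (open_weight p R \<omega>) \<le> 1 / p ^ card R"
      using open_weight_le[of R \<omega>] open_weight_nonneg[OF p(1), of R \<omega>] by simp
  qed
qed (use assms in auto)

lemma expectation_open_weight:
  assumes "finite R" "R \<subseteq> arcs G"
  shows "expectation (open_weight p R) = 1"
proof -
  have "expectation (open_weight p R) =
      expectation (\<lambda>\<omega>. indicator {\<omega> \<in> space (percolation G p). \<forall>e\<in>R. \<omega> e} \<omega> / p ^ card R)"
    by (intro Bochner_Integration.integral_cong refl) (simp add: open_weight_def)
  also have "\<dots> = 1" using assms p by (simp add: prob_all_open measure_def[symmetric])
  finally show ?thesis .
qed

text \<open>Common arcs are divided out twice but are open at the cost of a single factor. The
  surplus 1 / p ^ M, with M the number of common arcs, is the correlation that the intersection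
  tails must control.\<close>

lemma open_weight_mult:
  assumes "finite R" "finite R'"
  shows "open_weight p R \<omega> * open_weight p R' \<omega> = open_weight p (R \<union> R') \<omega> / p ^ card (R \<inter> R')"
proof -
  have "p ^ card R * p ^ card R' = p ^ card (R \<union> R') * p ^ card (R \<inter> R')"
    using card_Un_Int[OF assms] by (simp flip: power_add)
  then show ?thesis using p by (auto simp: open_weight_def)
qed

lemma integrable_open_weight_mult:
  assumes "finite R" "R \<subseteq> arcs G" "finite R'" "R' \<subseteq> arcs G"
  shows "integrable (percolation G p) (\<lambda>\<omega>. open_weight p R \<omega> * open_weight p R' \<omega>)"
  using assms integrable_open_weight[of "R \<union> R'"] by (simp add: open_weight_mult)

lemma expectation_open_weight_mult:
  assumes "finite R" "R \<subseteq> arcs G" "finite R'" "R' \<subseteq> arcs G"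
  shows "expectation (\<lambda>\<omega>. open_weight p R \<omega> * open_weight p R' \<omega>) = 1 / p ^ card (R \<inter> R')"
  using assms by (simp add: open_weight_mult expectation_open_weight)

text \<open>Here \<open>R i\<close> stands for the arcs of a segment, \<open>T i\<close> for its
  loop erasure, and \<open>J\<close> for the segments that end too close. The loss is 4 \<eta> from
  Chebyshev for the total weight at distance 1/2 from its mean 1, \<eta> from Markov for the energy,
  and 4 \<delta> from Markov for \<open>J\<close> at threshold 1/4.\<close>

lemma second_moment:
  fixes m :: "'i \<Rightarrow> real" and R T :: "'i \<Rightarrow> 'e set" and J :: "'i set"
  assumes I: "finite I" "\<And>i. i \<in> I \<Longrightarrow> finite (R i)" "\<And>i. i \<in> I \<Longrightarrow> R i \<subseteq> arcs G"
    and T: "\<And>i. i \<in> I \<Longrightarrow> T i \<subseteq> R i"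
    and m: "\<And>i. i \<in> I \<Longrightarrow> 0 \<le> m i" "(\<Sum>i\<in>I. m i) = 1"
    and J: "J \<subseteq> I" "(\<Sum>i\<in>J. m i) \<le> \<delta>"
    and \<eta>: "(\<Sum>i\<in>I. \<Sum>j\<in>I. m i * m j * (card (R i \<inter> R j) / p ^ card (R i \<inter> R j))) \<le> \<eta>"
  defines "Good \<equiv> {\<omega> \<in> space (percolation G p).
      1 / 2 \<le> (\<Sum>i\<in>I. m i * open_weight p (R i) \<omega>) \<and>
      (\<Sum>i\<in>I. \<Sum>j\<in>I. m i * open_weight p (R i) \<omega> * (m j * open_weight p (R j) \<omega>) * card (T i \<inter> T j)) \<le> 1 \<and>
      (\<Sum>i\<in>J. m i * open_weight p (R i) \<omega>) \<le> 1 / 4}"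
  shows "Good \<in> events" "1 - 5 * \<eta> - 4 * \<delta> \<le> prob Good"
proof -
  define Z where "Z \<omega> = (\<Sum>i\<in>I. m i * open_weight p (R i) \<omega>)" for \<omega>
  define W where "W \<omega> = (\<Sum>i\<in>I. \<Sum>j\<in>I. m i * open_weight p (R i) \<omega> * (m j * open_weight p (R j) \<omega>) * card (T i \<inter> T j))" for \<omega>
  define Y where "Y \<omega> = (\<Sum>i\<in>J. m i * open_weight p (R i) \<omega>)" for \<omega>
  have J': "\<And>i. i \<in> J \<Longrightarrow> i \<in> I" "finite J" using J I finite_subset by auto
  note int = integrable_open_weight[OF I(2,3)] integrable_open_weight_mult[OF I(2,3) I(2,3)]
  have meas: "open_weight p (R i) \<in> borel_measurable (percolation G p)" if "i \<in> I" for i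
    using I that by simp
  have [measurable]: "Z \<in> borel_measurable (percolation G p)" "W \<in> borel_measurable (percolation G p)"
    "Y \<in> borel_measurable (percolation G p)"
    unfolding Z_def[abs_def] W_def[abs_def] Y_def[abs_def] using meas J' by (auto intro!: borel_measurable_sum borel_measurable_times)
  have Good: "Good = {\<omega> \<in> space (percolation G p). 1 / 2 \<le> Z \<omega> \<and> W \<omega> \<le> 1 \<and> Y \<omega> \<le> 1 / 4}"
    by (simp add: Good_def Z_def W_def Y_def)
  show Good_ev: "Good \<in> events" unfolding Good by measurable
  have nonneg: "0 \<le> m i * open_weight p (R i) \<omega>" if "i \<in> I" for i \<omega>
    using m(1)[OF that] open_weight_nonneg[OF p(1), of "R i" \<omega>] by simp
  have intZ: "integrable (percolation G p) Z" unfolding Z_def[abs_def] using int by auto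
  have intY: "integrable (percolation G p) Y" unfolding Y_def[abs_def] using int J' by auto
  have EZ: "expectation Z = 1"
    unfolding Z_def using int I m by (simp add: expectation_open_weight)
  have EY: "expectation Y \<le> \<delta>"
    unfolding Y_def using int I J J' by (simp add: expectation_open_weight)
  have Z2: "(Z \<omega>)\<^sup>2 = (\<Sum>i\<in>I. \<Sum>j\<in>I. m i * m j * (open_weight p (R i) \<omega> * open_weight p (R j) \<omega>))" for \<omega>
    unfolding Z_def power2_eq_square sum_product by (simp add: mult_ac)
  have W': "W \<omega> = (\<Sum>i\<in>I. \<Sum>j\<in>I. m i * m j * card (T i \<inter> T j) * (open_weight p (R i) \<omega> * open_weight p (R j) \<omega>))" for \<omega>
    unfolding W_def by (simp add: mult_ac)
  have intZ2: "integrable (percolation G p) (\<lambda>\<omega>. (Z \<omega>)\<^sup>2)" unfolding Z2 using int by auto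
  have intW: "integrable (percolation G p) W" unfolding W'[abs_def] using int by auto
  have EZ2: "expectation (\<lambda>\<omega>. (Z \<omega>)\<^sup>2) = (\<Sum>i\<in>I. \<Sum>j\<in>I. m i * m j * (1 / p ^ card (R i \<inter> R j)))"
    unfolding Z2 using int by (simp add: expectation_open_weight_mult I)
  have EW: "expectation W = (\<Sum>i\<in>I. \<Sum>j\<in>I. m i * m j * card (T i \<inter> T j) * (1 / p ^ card (R i \<inter> R j)))"
    unfolding W' using int by (simp add: expectation_open_weight_mult I)
  have "expectation W \<le> (\<Sum>i\<in>I. \<Sum>j\<in>I. m i * m j * (card (R i \<inter> R j) / p ^ card (R i \<inter> R j)))"
    unfolding EW
  proof (intro sum_mono)
    fix i j assume ij: "i \<in> I" "j \<in> I"
    then have "card (T i \<inter> T j) \<le> card (R i \<inter> R j)" using T I by (intro card_mono) auto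
    then have "card (T i \<inter> T j) / p ^ card (R i \<inter> R j) \<le> card (R i \<inter> R j) / p ^ card (R i \<inter> R j)"
      using p by (intro divide_right_mono) auto
    from mult_left_mono[OF this, of "m i * m j"]
    show "m i * m j * card (T i \<inter> T j) * (1 / p ^ card (R i \<inter> R j))
        \<le> m i * m j * (card (R i \<inter> R j) / p ^ card (R i \<inter> R j))"
      using m ij by simp
  qed
  with \<eta> have EW': "expectation W \<le> \<eta>" by simp
  have "expectation (\<lambda>\<omega>. (Z \<omega> - 1)\<^sup>2) = expectation (\<lambda>\<omega>. (Z \<omega>)\<^sup>2) - 1"
    using intZ intZ2 EZ by (simp add: power2_diff prob_space)
  also have "\<dots> = (\<Sum>i\<in>I. \<Sum>j\<in>I. m i * m j * (1 / p ^ card (R i \<inter> R j) - 1))"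
  proof -
    have "1 = (\<Sum>i\<in>I. \<Sum>j\<in>I. m i * m j)" using m(2) by (simp flip: sum_product)
    then show ?thesis unfolding EZ2 by (simp add: right_diff_distrib sum_subtractf)
  qed
  also have "\<dots> \<le> (\<Sum>i\<in>I. \<Sum>j\<in>I. m i * m j * (card (R i \<inter> R j) / p ^ card (R i \<inter> R j)))"
  proof (intro sum_mono mult_left_mono)
    fix i j
    \<comment> \<open>For M = 0 both sides vanish; for M at least 1 already 1 / p ^ M is at most M /
      p ^ M. Hence one bound \<eta> serves variance and energy alike.\<close>
    show "1 / p ^ card (R i \<inter> R j) - 1 \<le> card (R i \<inter> R j) / p ^ card (R i \<inter> R j)"
    proof (cases "card (R i \<inter> R j) = 0")
      case False
      then have "1 / p ^ card (R i \<inter> R j) \<le> card (R i \<inter> R j) / p ^ card (R i \<inter> R j)"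
        using p by (intro divide_right_mono) auto
      then show ?thesis by simp
    qed simp
  qed (use m in auto)
  finally have VZ: "expectation (\<lambda>\<omega>. (Z \<omega> - 1)\<^sup>2) \<le> \<eta>" using \<eta> by simp
  have intV: "integrable (percolation G p) (\<lambda>\<omega>. (Z \<omega> - 1)\<^sup>2)"
    using intZ intZ2 by (simp add: power2_diff)
  have W0: "0 \<le> W \<omega>" for \<omega> unfolding W_def using m(1) open_weight_nonneg[OF p(1)]
    by (intro sum_nonneg mult_nonneg_nonneg) auto
  have Y0: "0 \<le> Y \<omega>" for \<omega> unfolding Y_def using nonneg J' by (intro sum_nonneg) auto
  let ?A = "{\<omega> \<in> space (percolation G p). 1 / 4 \<le> (Z \<omega> - 1)\<^sup>2}"
  let ?B = "{\<omega> \<in> space (percolation G p). 1 \<le> W \<omega>}"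
  let ?C = "{\<omega> \<in> space (percolation G p). 1 / 4 \<le> Y \<omega>}"
  have A: "prob ?A \<le> 4 * \<eta>"
    using integral_Markov_inequality_measure[OF intV, of "{}" "1/4"] VZ by simp
  have B: "prob ?B \<le> \<eta>"
    using integral_Markov_inequality_measure[OF intW, of "{}" 1] EW' W0 by simp
  have C: "prob ?C \<le> 4 * \<delta>"
    using integral_Markov_inequality_measure[OF intY, of "{}" "1/4"] EY Y0 by simp
  have "space (percolation G p) - Good \<subseteq> ?A \<union> (?B \<union> ?C)"
  proof
    fix \<omega> assume \<omega>: "\<omega> \<in> space (percolation G p) - Good"
    have "1 / 4 \<le> (Z \<omega> - 1)\<^sup>2" if "Z \<omega> < 1 / 2"
    proof -
      have "(1 / 2)\<^sup>2 \<le> (1 - Z \<omega>)\<^sup>2" using that by (intro power_mono) auto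
      then show ?thesis by (simp add: power2_commute power_divide)
    qed
    with \<omega> show "\<omega> \<in> ?A \<union> (?B \<union> ?C)" by (auto simp: Good not_le)
  qed
  then have "prob (space (percolation G p) - Good) \<le> prob (?A \<union> (?B \<union> ?C))"
    by (intro finite_measure_mono) auto
  also have "\<dots> \<le> prob ?A + prob (?B \<union> ?C)" by (intro measure_Un_le) auto
  also have "prob (?B \<union> ?C) \<le> prob ?B + prob ?C" by (intro measure_Un_le) auto
  finally have "1 - prob Good \<le> prob ?A + (prob ?B + prob ?C)" using prob_compl[OF Good_ev] by simp
  with A B C show "1 - 5 * \<eta> - 4 * \<delta> \<le> prob Good" by linarith
qed

end

section \<open>Uniform smallness of late intersections\<close>

text \<open>Forward balls: arcs are followed from tail to head only. They are finite by local
  finiteness and contain everything a path from \<open>v\<close> can see, which yields countability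
  even if \<open>verts G\<close> is uncountable.\<close>

primrec reach_ball :: "('v, 'e) pre_digraph \<Rightarrow> 'v \<Rightarrow> nat \<Rightarrow> 'v set" where
  "reach_ball G v 0 = {v}"
| "reach_ball G v (Suc n) = reach_ball G v n \<union> (\<Union>x\<in>reach_ball G v n. head G ` out_arcs G x)"

text \<open>For \<open>k = 0\<close> this is the event in \<open>EIT\<close>. Discarding the first
  \<open>k\<close> arcs of both paths shrinks it, which is how the second moment is made
  small.\<close>

definition meet_late :: "(nat \<Rightarrow> 'e) measure \<Rightarrow> nat \<Rightarrow> nat \<Rightarrow> ((nat \<Rightarrow> 'e) \<times> (nat \<Rightarrow> 'e)) set" where
  "meet_late \<mu> k n = {(\<phi>, \<psi>) \<in> space \<mu> \<times> space \<mu>.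
     infinite (\<phi> ` {k..} \<inter> \<psi> ` {k..}) \<or> n \<le> card (\<phi> ` {k..} \<inter> \<psi> ` {k..})}"

lemma reach_ball_mono: "i \<le> j \<Longrightarrow> reach_ball G v i \<subseteq> reach_ball G v j"
  by (rule lift_Suc_mono_le) auto

text \<open>Replaces a cardinality by the existence of a finite witness, so that
  \<open>meet_late\<close> becomes a countable union.\<close>

lemma infinite_or_card_ge_iff:
  "infinite X \<or> n \<le> card X \<longleftrightarrow> (\<exists>T. finite T \<and> card T = n \<and> T \<subseteq> X)"
proof
  assume "infinite X \<or> n \<le> card X"
  then show "\<exists>T. finite T \<and> card T = n \<and> T \<subseteq> X"
    by (meson infinite_arbitrarily_large obtain_subset_with_card_n)
qed (metis card_mono)

locale EIT_paths =
  fixes G :: "('v, 'e) pre_digraph" and v\<^sub>0 :: 'v and \<mu> :: "(nat \<Rightarrow> 'e) measure" and \<theta> p :: real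
  assumes wf: "wf_digraph G" and fin: "locally_finite G" and v0: "v\<^sub>0 \<in> verts G"
    and borel: "borel_prob_on_paths G v\<^sub>0 \<mu>"
    and \<theta>: "0 < \<theta>" "\<theta> < p" "p < 1" and EIT: "EIT \<mu> \<theta>"
begin

section \<open>Finite forward balls and measurability on path space\<close>

lemma reach_ball_verts: "reach_ball G v\<^sub>0 n \<subseteq> verts G"
  by (induction n) (use v0 wf wf_digraph.head_in_verts in auto)

lemma finite_reach_ball: "finite (reach_ball G v\<^sub>0 n)"
proof (induction n)
  case (Suc n)
  then show ?case using fin reach_ball_verts[of n] by (auto simp: locally_finite_def subset_iff)
qed simp

lemma finite_out_arcs_reach_ball: "finite (\<Union>x\<in>reach_ball G v\<^sub>0 n. out_arcs G x)"
  using finite_reach_ball fin reach_ball_verts[of n] by (auto simp: locally_finite_def subset_iff)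

lemma path_tail_reach_ball:
  assumes "\<phi> \<in> paths_to_infinity G v\<^sub>0"
  shows "tail G (\<phi> i) \<in> reach_ball G v\<^sub>0 i"
proof (induction i)
  case 0
  then show ?case using assms by (simp add: paths_to_infinity_def)
next
  case (Suc i)
  have "tail G (\<phi> (Suc i)) = head G (\<phi> i)" "\<phi> i \<in> out_arcs G (tail G (\<phi> i))"
    using assms by (auto simp: paths_to_infinity_def)
  with Suc have "tail G (\<phi> (Suc i)) \<in> (\<Union>x\<in>reach_ball G v\<^sub>0 i. head G ` out_arcs G x)" by blast
  then show ?case by simp
qed

lemma path_arc_reach_ball:
  assumes "\<phi> \<in> paths_to_infinity G v\<^sub>0"
  shows "\<phi> i \<in> (\<Union>x\<in>reach_ball G v\<^sub>0 i. out_arcs G x)"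
  using path_tail_reach_ball[OF assms, of i] assms by (auto simp: paths_to_infinity_def)

lemma finite_arc_visits:
  assumes "\<phi> \<in> paths_to_infinity G v\<^sub>0"
  shows "finite {i. \<phi> i = e}"
proof (cases "e \<in> arcs G")
  case True
  then have "finite {i. tail G (\<phi> i) = tail G e}"
    using assms wf by (auto simp: paths_to_infinity_def wf_digraph.tail_in_verts)
  then show ?thesis by (rule rev_finite_subset) auto
next
  case False
  then have "{i. \<phi> i = e} = {}" using assms by (auto simp: paths_to_infinity_def)
  then show ?thesis by simp
qed

lemma space_paths: "space \<mu> = paths_to_infinity G v\<^sub>0"
  using borel by (simp add: borel_prob_on_paths_def)

lemma prob_space_paths: "prob_space \<mu>"
  using borel by (simp add: borel_prob_on_paths_def)

text \<open>Every set of arcs has a measurable preimage, because the arc at time \<open>i\<close>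
  leaves a finite ball: the preimage is a finite union of open cylinders.\<close>

lemma coordinate_measurable: "(\<lambda>\<phi>. \<phi> i) \<in> measurable \<mu> (count_space UNIV)"
proof (rule measurableI)
  fix X :: "'e set"
  let ?A = "\<Union>x\<in>reach_ball G v\<^sub>0 i. out_arcs G x"
  have cyl: "{\<phi> \<in> space \<mu>. \<phi> i = e} \<in> sets \<mu>" if "e \<in> ?A" for e
  proof -
    let ?T = "product_topology (\<lambda>_::nat. discrete_topology (arcs G)) UNIV"
    have e: "e \<in> arcs G" using that by auto
    have "openin ?T {\<phi> \<in> topspace ?T. \<phi> i \<in> {e}}"
      by (rule openin_continuous_map_preimage[OF continuous_map_product_projection]) (use e in auto)
    then have "openin (path_topology G v\<^sub>0) ({\<phi> \<in> topspace ?T. \<phi> i \<in> {e}} \<inter> paths_to_infinity G v\<^sub>0)"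
      unfolding path_topology_def openin_subtopology by blast
    moreover have "{\<phi> \<in> topspace ?T. \<phi> i \<in> {e}} \<inter> paths_to_infinity G v\<^sub>0 = {\<phi> \<in> space \<mu>. \<phi> i = e}"
      by (auto simp: space_paths paths_to_infinity_def)
    ultimately show ?thesis
      using borel by (auto simp: borel_prob_on_paths_def intro!: sigma_sets.Basic)
  qed
  have "(\<lambda>\<phi>. \<phi> i) -` X \<inter> space \<mu> = (\<Union>e\<in>X \<inter> ?A. {\<phi> \<in> space \<mu>. \<phi> i = e})"
    using path_arc_reach_ball by (auto simp: space_paths)
  also have "\<dots> \<in> sets \<mu>"
    using cyl finite_out_arcs_reach_ball[of i] by (intro sets.finite_UN) auto
  finally show "(\<lambda>\<phi>. \<phi> i) -` X \<inter> space \<mu> \<in> sets \<mu>" .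
qed simp

lemmas [measurable] = coordinate_measurable
  measurable_compose[OF measurable_fst coordinate_measurable]
  measurable_compose[OF measurable_snd coordinate_measurable]

lemma meet_late_measurable: "meet_late \<mu> k n \<in> sets (\<mu> \<Otimes>\<^sub>M \<mu>)"
proof -
  define A where "A = (\<Union>i. \<Union>x\<in>reach_ball G v\<^sub>0 i. out_arcs G x)"
  define TT where "TT = {T. finite T \<and> T \<subseteq> A} \<inter> {T. card T = n}"
  define B where "B T = {z \<in> space (\<mu> \<Otimes>\<^sub>M \<mu>). \<forall>e\<in>T. (\<exists>i\<ge>k. fst z i = e) \<and> (\<exists>i\<ge>k. snd z i = e)}" for T
  have "countable A" unfolding A_def
  proof (rule countable_UN)
    show "countable (\<Union>x\<in>reach_ball G v\<^sub>0 i. out_arcs G x)" for i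
      by (rule countable_finite[OF finite_out_arcs_reach_ball])
  qed simp
  then have TT: "countable TT" unfolding TT_def by (intro countable_Int1 countable_Collect_finite_subset)
  have "z \<in> meet_late \<mu> k n \<longleftrightarrow> z \<in> (\<Union>T\<in>TT. B T)" for z :: "(nat \<Rightarrow> 'e) \<times> (nat \<Rightarrow> 'e)"
  proof -
    obtain \<phi> \<psi> where z: "z = (\<phi>, \<psi>)" by (cases z)
    show ?thesis
    proof (cases "\<phi> \<in> space \<mu> \<and> \<psi> \<in> space \<mu>")
      case True
      have "\<phi> i \<in> A" for i
        using path_arc_reach_ball[of \<phi> i] True unfolding A_def space_paths by blast
      then have A: "\<phi> ` {k..} \<subseteq> A" by auto
      have "z \<in> meet_late \<mu> k n \<longleftrightarrow> (\<exists>T. finite T \<and> card T = n \<and> T \<subseteq> \<phi> ` {k..} \<inter> \<psi> ` {k..})"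
        using True by (simp only: z meet_late_def infinite_or_card_ge_iff) simp
      also have "\<dots> \<longleftrightarrow> (\<exists>T\<in>TT. T \<subseteq> \<phi> ` {k..} \<inter> \<psi> ` {k..})"
      proof -
        have "T \<subseteq> A" if "T \<subseteq> \<phi> ` {k..} \<inter> \<psi> ` {k..}" for T using that A by blast
        then show ?thesis unfolding TT_def by blast
      qed
      also have "\<dots> \<longleftrightarrow> (\<exists>T\<in>TT. z \<in> B T)"
      proof -
        have "e \<in> \<phi> ` {k..} \<inter> \<psi> ` {k..} \<longleftrightarrow> (\<exists>i\<ge>k. fst z i = e) \<and> (\<exists>i\<ge>k. snd z i = e)" for e
          unfolding z fst_conv snd_conv image_iff Int_iff Bex_def atLeast_iff by metis
        then show ?thesis using True by (simp add: B_def subset_eq z space_pair_measure)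
      qed
      finally show ?thesis by simp
    qed (auto simp: z meet_late_def B_def space_pair_measure)
  qed
  then have "meet_late \<mu> k n = (\<Union>T\<in>TT. B T)" by blast
  moreover have "B T \<in> sets (\<mu> \<Otimes>\<^sub>M \<mu>)" if "T \<in> TT" for T
  proof -
    have "Measurable.pred (\<mu> \<Otimes>\<^sub>M \<mu>) (\<lambda>z. \<forall>e\<in>T. (\<exists>i\<ge>k. fst z i = e) \<and> (\<exists>i\<ge>k. snd z i = e))"
    proof (rule pred_intros_finite)
      fix e
      show "Measurable.pred (\<mu> \<Otimes>\<^sub>M \<mu>) (\<lambda>z. (\<exists>i\<ge>k. fst z i = e) \<and> (\<exists>i\<ge>k. snd z i = e))"
        by measurable
    qed (use that in \<open>simp add: TT_def\<close>)
    then show ?thesis by (simp add: B_def pred_def)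
  qed
  ultimately show ?thesis by (auto intro!: sets.countable_UN'[OF TT])
qed

section \<open>Decay of late intersections\<close>

lemma meet_late_antimono:
  assumes "k \<le> l" "n \<le> m"
  shows "meet_late \<mu> l m \<subseteq> meet_late \<mu> k n"
proof -
  have "infinite (\<phi> ` {k..} \<inter> \<psi> ` {k..}) \<or> n \<le> card (\<phi> ` {k..} \<inter> \<psi> ` {k..})"
    if "infinite (\<phi> ` {l..} \<inter> \<psi> ` {l..}) \<or> m \<le> card (\<phi> ` {l..} \<inter> \<psi> ` {l..})" for \<phi> \<psi> :: "nat \<Rightarrow> 'e"
  proof -
    have "\<phi> ` {l..} \<inter> \<psi> ` {l..} \<subseteq> \<phi> ` {k..} \<inter> \<psi> ` {k..}" using assms by auto
    with that assms show ?thesis using infinite_super card_mono le_trans by metis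
  qed
  then show ?thesis unfolding meet_late_def by blast
qed

text \<open>Here it matters that paths tend to infinity. If the common arcs were finitely many, the
  first path would use them only before some time \<open>k\<close>, and the paths would share
  nothing afterwards.\<close>

lemma meet_late_infinite:
  assumes "z \<in> (\<Inter>k. meet_late \<mu> k 1)"
  shows "z \<in> meet_late \<mu> 0 n"
proof -
  obtain \<phi> \<psi> where z: "z = (\<phi>, \<psi>)" by (cases z)
  have sp: "\<phi> \<in> space \<mu>" "\<psi> \<in> space \<mu>" using assms by (auto simp: z meet_late_def)
  have "infinite (range \<phi> \<inter> range \<psi>)"
  proof
    assume f: "finite (range \<phi> \<inter> range \<psi>)"
    then have "finite (\<Union>e\<in>range \<phi> \<inter> range \<psi>. {i. \<phi> i = e})"
      using finite_arc_visits sp by (auto simp: space_paths)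
    then obtain k where k: "\<And>i. i \<in> (\<Union>e\<in>range \<phi> \<inter> range \<psi>. {i. \<phi> i = e}) \<Longrightarrow> i < k"
      by (meson finite_nat_set_iff_bounded)
    have "\<phi> ` {k..} \<inter> \<psi> ` {k..} = {}" using k by (fastforce simp: image_iff)
    moreover have "(\<phi>, \<psi>) \<in> meet_late \<mu> k 1" using assms z by blast
    ultimately show False by (simp add: meet_late_def)
  qed
  then show ?thesis using sp by (simp add: z meet_late_def atLeast_0)
qed

lemma summable_meet_late_bound: "summable (\<lambda>n. real n / p ^ n * (C * \<theta> ^ n))"
proof -
  have "norm (\<theta> / p) < 1" using \<theta> by simp
  then have "summable (\<lambda>n. real (Suc n) * (\<theta> / p) ^ n)"
    using geometric_deriv_sums sums_summable by blast
  then have "summable (\<lambda>n. real (Suc n) * (\<theta> / p) ^ n * (C * (\<theta> / p)))" by (rule summable_mult2)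
  then have "summable (\<lambda>n. real (Suc n) / p ^ Suc n * (C * \<theta> ^ Suc n))"
    by (simp add: power_divide mult_ac)
  then show ?thesis by (subst (asm) summable_Suc_iff)
qed

lemma meet_late_le:
  obtains C where "\<And>k n. measure (\<mu> \<Otimes>\<^sub>M \<mu>) (meet_late \<mu> k n) \<le> C * \<theta> ^ n"
proof -
  interpret \<mu>: prob_space \<mu> by (rule prob_space_paths)
  interpret pair_prob_space \<mu> \<mu> ..
  obtain C where C: "\<And>n. measure (\<mu> \<Otimes>\<^sub>M \<mu>) (meet_late \<mu> 0 n) \<le> C * \<theta> ^ n"
    using EIT by (auto simp: EIT_def meet_late_def atLeast_0)
  have "measure (\<mu> \<Otimes>\<^sub>M \<mu>) (meet_late \<mu> k n) \<le> measure (\<mu> \<Otimes>\<^sub>M \<mu>) (meet_late \<mu> 0 n)" for k n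
    by (intro finite_measure_mono meet_late_antimono meet_late_measurable) auto
  with C that show ?thesis using order_trans by blast
qed

text \<open>The events decrease to one on which infinitely many arcs are shared. Its probability is
  at most C \<theta>^n for every n, hence 0.\<close>

lemma meet_late_tendsto_0: "(\<lambda>k. measure (\<mu> \<Otimes>\<^sub>M \<mu>) (meet_late \<mu> k 1)) \<longlonglongrightarrow> 0"
proof -
  interpret \<mu>: prob_space \<mu> by (rule prob_space_paths)
  interpret pair_prob_space \<mu> \<mu> ..
  obtain C where C: "\<And>k n. measure (\<mu> \<Otimes>\<^sub>M \<mu>) (meet_late \<mu> k n) \<le> C * \<theta> ^ n" using meet_late_le by blast
  let ?L = "measure (\<mu> \<Otimes>\<^sub>M \<mu>) (\<Inter>k. meet_late \<mu> k 1)"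
  have "?L \<le> C * \<theta> ^ n" for n
  proof -
    have "?L \<le> measure (\<mu> \<Otimes>\<^sub>M \<mu>) (meet_late \<mu> 0 n)"
      using meet_late_infinite by (intro finite_measure_mono meet_late_measurable subsetI)
    with C show ?thesis using order_trans by blast
  qed
  moreover have "(\<lambda>n. C * \<theta> ^ n) \<longlonglongrightarrow> C * 0"
    using \<theta> by (intro tendsto_mult_left LIMSEQ_realpow_zero) auto
  ultimately have "?L \<le> 0" by (intro LIMSEQ_le_const) auto
  then have "?L = 0" using measure_nonneg[of "\<mu> \<Otimes>\<^sub>M \<mu>"] by (simp add: antisym)
  moreover have "(\<lambda>k. measure (\<mu> \<Otimes>\<^sub>M \<mu>) (meet_late \<mu> k 1)) \<longlonglongrightarrow> ?L"
    using meet_late_measurable meet_late_antimono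
    by (intro finite_Lim_measure_decseq) (auto simp: decseq_def)
  ultimately show ?thesis by simp
qed

text \<open>Dominated convergence for series: each term tends to 0 as \<open>k\<close> grows, and n
  C (\<theta> / p)^n is a summable majorant because \<theta> < p.\<close>

lemma weighted_meet_late_small:
  assumes "0 < \<epsilon>"
  shows "\<exists>k. \<forall>N. (\<Sum>n\<le>N. real n / p ^ n * measure (\<mu> \<Otimes>\<^sub>M \<mu>) (meet_late \<mu> k n)) \<le> \<epsilon>"
proof -
  interpret \<mu>: prob_space \<mu> by (rule prob_space_paths)
  interpret pair_prob_space \<mu> \<mu> ..
  obtain C where C: "\<And>k n. measure (\<mu> \<Otimes>\<^sub>M \<mu>) (meet_late \<mu> k n) \<le> C * \<theta> ^ n" using meet_late_le by blast
  let ?a = "\<lambda>n k. real n / p ^ n * measure (\<mu> \<Otimes>\<^sub>M \<mu>) (meet_late \<mu> k n)"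
  have p0: "0 < p" using \<theta> by simp
  have lim: "(\<lambda>k. ?a n k) \<longlonglongrightarrow> 0" for n
  \<comment> \<open>For n = 0 the event has full measure, but the factor n removes the term; for
    positive n the event lies inside the one for 1.\<close>
  proof (cases n)
    case (Suc m)
    have "(\<lambda>k. measure (\<mu> \<Otimes>\<^sub>M \<mu>) (meet_late \<mu> k n)) \<longlonglongrightarrow> 0"
      using meet_late_antimono meet_late_measurable Suc
      by (intro tendsto_sandwich[OF _ _ tendsto_const meet_late_tendsto_0] always_eventually allI finite_measure_mono) auto
    then show ?thesis using tendsto_mult_left[of _ 0 _ "real n / p ^ n"] by simp
  qed simp
  have bound: "norm (?a n k) \<le> real n / p ^ n * (C * \<theta> ^ n)" for n k
    using mult_left_mono[OF C[of k n], of "real n / p ^ n"] p0 by (simp add: abs_mult)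
  have sum: "eventually (\<lambda>k. summable (\<lambda>n. norm (?a n k))) sequentially \<and> summable (\<lambda>n. norm (0::real)) \<and>
    ((\<lambda>k. \<Sum>n. ?a n k) \<longlongrightarrow> (\<Sum>n. 0)) sequentially"
    using bound by (intro tannerys_theorem[where a = ?a and M = "\<lambda>n. real n / p ^ n * (C * \<theta> ^ n)"]
        lim summable_meet_late_bound[of C] always_eventually) auto
  then have "((\<lambda>k. \<Sum>n. ?a n k) \<longlongrightarrow> 0) sequentially" by simp
  from order_tendstoD(2)[OF this assms] sum
  have "eventually (\<lambda>k. summable (\<lambda>n. norm (?a n k)) \<and> (\<Sum>n. ?a n k) < \<epsilon>) sequentially"
    by (intro eventually_conj) auto
  then obtain k where k: "summable (\<lambda>n. norm (?a n k))" "(\<Sum>n. ?a n k) < \<epsilon>"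
    using eventually_happens[of _ sequentially] sequentially_bot by blast
  have "(\<Sum>n\<le>N. ?a n k) \<le> (\<Sum>n. ?a n k)" for N
    using summable_norm_cancel[OF k(1)] p0 by (intro sum_le_suminf) auto
  with k(2) show ?thesis by (meson less_imp_le order_trans)
qed

section \<open>Percolation along path segments\<close>

text \<open>There are \<open>Suc N\<close> arcs, so a segment is never empty and \<open>hd\<close>
  and \<open>last\<close> are meaningful.\<close>

definition segment :: "nat \<Rightarrow> nat \<Rightarrow> (nat \<Rightarrow> 'e) \<Rightarrow> 'e list" where
  "segment k N \<phi> = map \<phi> [k..<k + Suc N]"

definition segments :: "nat \<Rightarrow> nat \<Rightarrow> 'e list set" where
  "segments k N = segment k N ` space \<mu>"

definition mass :: "nat \<Rightarrow> nat \<Rightarrow> 'e list \<Rightarrow> real" where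
  "mass k N u = measure \<mu> {\<phi> \<in> space \<mu>. segment k N \<phi> = u}"

text \<open>A segment may use an arc many times. Erasing its loops makes the flow through an arc at most the
  total weight of the segments containing it, so that counting common arcs without multiplicity
  controls the energy.\<close>

definition loop_erase :: "'e list \<Rightarrow> 'e list" where
  "loop_erase u = wf_digraph.awalk_to_apath G u"

lemma p_pos: "0 < p" and p_less_1: "p < 1"
  using \<theta> by simp_all

lemma hd_segment: "hd (segment k N \<phi>) = \<phi> k"
  unfolding segment_def by (subst upt_conv_Cons) auto

lemma last_segment: "last (segment k N \<phi>) = \<phi> (k + N)"
  by (simp add: segment_def)

lemma set_segment: "set (segment k N \<phi>) = \<phi> ` {k..k + N}"
  by (auto simp: segment_def simp del: upt_Suc)

lemma length_segment: "length (segment k N \<phi>) = Suc N"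
  by (simp add: segment_def)

lemma finite_segments: "finite (segments k N)"
proof (rule finite_subset)
  let ?A = "\<Union>x\<in>reach_ball G v\<^sub>0 (k + N). out_arcs G x"
  show "finite {u. set u \<subseteq> ?A \<and> length u = Suc N}"
    by (rule finite_lists_length_eq[OF finite_out_arcs_reach_ball])
  show "segments k N \<subseteq> {u. set u \<subseteq> ?A \<and> length u = Suc N}"
  proof
    fix u assume "u \<in> segments k N"
    then obtain \<phi> where \<phi>: "\<phi> \<in> paths_to_infinity G v\<^sub>0" "u = segment k N \<phi>"
      by (auto simp: segments_def space_paths)
    have "\<phi> i \<in> ?A" if "i \<le> k + N" for i
      using path_arc_reach_ball[OF \<phi>(1), of i] reach_ball_mono[OF that, of G v\<^sub>0] by blast
    then show "u \<in> {u. set u \<subseteq> ?A \<and> length u = Suc N}"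
      by (auto simp: \<phi>(2) set_segment length_segment)
  qed
qed

lemma segment_arcs: "u \<in> segments k N \<Longrightarrow> set u \<subseteq> arcs G"
  by (auto simp: segments_def set_segment space_paths paths_to_infinity_def)

lemma segment_start: "u \<in> segments k N \<Longrightarrow> tail G (hd u) \<in> reach_ball G v\<^sub>0 k"
  by (auto simp: segments_def hd_segment space_paths path_tail_reach_ball)

lemma segment_awalk:
  assumes "u \<in> segments k N"
  shows "pre_digraph.awalk G (tail G (hd u)) u (head G (last u))"
proof -
  interpret wf_digraph G by (rule wf)
  obtain \<phi> where \<phi>: "\<phi> \<in> paths_to_infinity G v\<^sub>0" "u = segment k N \<phi>"
    using assms by (auto simp: segments_def space_paths)
  have arc: "\<phi> i \<in> arcs G" "head G (\<phi> i) = tail G (\<phi> (Suc i))" for i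
    using \<phi>(1) by (auto simp: paths_to_infinity_def)
  have "awalk (tail G (\<phi> k)) (map \<phi> [k..<k + Suc N]) (head G (\<phi> (k + N)))"
  proof (induction N)
    case 0
    show ?case using arc_implies_awalk[OF arc(1)] by simp
  next
    case (Suc N)
    have "awalk (head G (\<phi> (k + N))) [\<phi> (k + Suc N)] (head G (\<phi> (k + Suc N)))"
      using arc_implies_awalk[OF arc(1)] arc(2)[of "k + N"] by simp
    from awalk_appendI[OF Suc this] show ?case by simp
  qed
  then show ?thesis by (simp only: \<phi>(2) hd_segment last_segment) (simp add: segment_def)
qed

lemma loop_erase_subset:
  assumes "u \<in> segments k N"
  shows "set (loop_erase u) \<subseteq> set u"
  unfolding loop_erase_def by (rule wf_digraph.awalk_to_apath_subset[OF wf segment_awalk[OF assms]])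

text \<open>The erased walk visits no vertex twice, so it repeats no arc either; its arcs are among
  those of \<open>u\<close> and therefore open.\<close>

lemma loop_erase_trail:
  assumes "u \<in> segments k N" "\<forall>e\<in>set u. \<omega> e"
  shows "pre_digraph.trail (open_subgraph G \<omega>) (tail G (hd u)) (loop_erase u) (head G (last u))"
proof -
  interpret wf_digraph G by (rule wf)
  have "apath (tail G (hd u)) (loop_erase u) (head G (last u))"
    unfolding loop_erase_def by (rule apath_awalk_to_apath[OF segment_awalk[OF assms(1)]])
  then have "awalk (tail G (hd u)) (loop_erase u) (head G (last u))" "distinct (loop_erase u)"
    using distinct_verts_imp_distinct by (auto simp: apath_def)
  moreover have "pre_digraph.cas (open_subgraph G \<omega>) = cas"
    by (rule compatible_cas) (simp add: compatible_def)
  moreover have "\<forall>e\<in>set (loop_erase u). \<omega> e" using loop_erase_subset[OF assms(1)] assms(2) by blast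
  ultimately show ?thesis
    by (auto simp: pre_digraph.trail_def pre_digraph.awalk_def)
qed

section \<open>Masses of segments and of pairs of segments\<close>

lemma segment_measurable: "{\<phi> \<in> space \<mu>. segment k N \<phi> = u} \<in> sets \<mu>"
proof -
  have "segment k N \<phi> = u \<longleftrightarrow> length u = Suc N \<and> (\<forall>i<Suc N. \<phi> (k + i) = u ! i)" for \<phi>
    by (auto simp: segment_def list_eq_iff_nth_eq simp del: upt_Suc)
  then show ?thesis by simp
qed

lemma mass_nonneg: "0 \<le> mass k N u"
  by (simp add: mass_def)

lemma sum_mass:
  assumes "J \<subseteq> segments k N"
  shows "(\<Sum>u\<in>J. mass k N u) = measure \<mu> {\<phi> \<in> space \<mu>. segment k N \<phi> \<in> J}"
proof -
  interpret prob_space \<mu> by (rule prob_space_paths)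
  have "finite J" using assms finite_segments finite_subset by blast
  then have "measure \<mu> (\<Union>u\<in>J. {\<phi> \<in> space \<mu>. segment k N \<phi> = u}) = (\<Sum>u\<in>J. mass k N u)"
    unfolding mass_def using segment_measurable
    by (intro finite_measure_finite_Union) (auto simp: disjoint_family_on_def)
  moreover have "(\<Union>u\<in>J. {\<phi> \<in> space \<mu>. segment k N \<phi> = u}) = {\<phi> \<in> space \<mu>. segment k N \<phi> \<in> J}"
    by blast
  ultimately show ?thesis by simp
qed

lemma sum_mass_segments: "(\<Sum>u\<in>segments k N. mass k N u) = 1"
proof -
  interpret prob_space \<mu> by (rule prob_space_paths)
  have "{\<phi> \<in> space \<mu>. segment k N \<phi> \<in> segments k N} = space \<mu>" by (auto simp: segments_def)
  then show ?thesis by (simp add: sum_mass prob_space)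
qed

lemma sum_mass_pairs:
  "(\<Sum>u\<in>segments k N. \<Sum>w\<in>segments k N. mass k N u * mass k N w * of_bool (P u w))
    = measure (\<mu> \<Otimes>\<^sub>M \<mu>) {(\<phi>, \<psi>) \<in> space \<mu> \<times> space \<mu>. P (segment k N \<phi>) (segment k N \<psi>)}"
proof -
  interpret \<mu>: prob_space \<mu> by (rule prob_space_paths)
  interpret pair_prob_space \<mu> \<mu> ..
  let ?I = "segments k N"
  let ?A = "\<lambda>u. {\<phi> \<in> space \<mu>. segment k N \<phi> = u}"
  define S where "S = {(u, w) \<in> ?I \<times> ?I. P u w}"
  have fS: "finite S" unfolding S_def by (rule finite_subset[of _ "?I \<times> ?I"]) (auto simp: finite_segments)
  have AA: "measure (\<mu> \<Otimes>\<^sub>M \<mu>) (?A u \<times> ?A w) = mass k N u * mass k N w" for u w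
    unfolding mass_def
    using \<mu>.emeasure_pair_measure_Times[OF segment_measurable[of k N u] segment_measurable[of k N w]]
    by (simp add: measure_def enn2real_mult)
  have "(\<Sum>u\<in>?I. \<Sum>w\<in>?I. mass k N u * mass k N w * of_bool (P u w))
      = (\<Sum>(u, w)\<in>?I \<times> ?I. mass k N u * mass k N w * of_bool (P u w))"
    by (rule sum.cartesian_product)
  also have "\<dots> = (\<Sum>(u, w)\<in>S. mass k N u * mass k N w)"
    by (rule sum.mono_neutral_cong_right) (auto simp: S_def finite_segments)
  also have "\<dots> = (\<Sum>z\<in>S. measure (\<mu> \<Otimes>\<^sub>M \<mu>) (?A (fst z) \<times> ?A (snd z)))"
    by (simp add: AA case_prod_beta)
  also have "\<dots> = measure (\<mu> \<Otimes>\<^sub>M \<mu>) (\<Union>z\<in>S. ?A (fst z) \<times> ?A (snd z))"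
    using fS segment_measurable
    by (intro finite_measure_finite_Union[symmetric]) (auto simp: disjoint_family_on_def prod_eq_iff)
  also have "(\<Union>z\<in>S. ?A (fst z) \<times> ?A (snd z))
      = {(\<phi>, \<psi>) \<in> space \<mu> \<times> space \<mu>. P (segment k N \<phi>) (segment k N \<psi>)}"
    by (auto simp: S_def segments_def) blast
  finally show ?thesis .
qed

text \<open>Passes from the number M of common arcs to tail probabilities: M / p ^ M is one of the
  terms n / p ^ n with n at most M, so it is at most their sum. The sum may stop at
  \<open>Suc N\<close>, the length of a segment.\<close>

lemma segment_energy_le:
  "(\<Sum>u\<in>segments k N. \<Sum>w\<in>segments k N.
      mass k N u * mass k N w * (card (set u \<inter> set w) / p ^ card (set u \<inter> set w)))
    \<le> (\<Sum>n\<le>Suc N. real n / p ^ n * measure (\<mu> \<Otimes>\<^sub>M \<mu>) (meet_late \<mu> k n))"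
proof -
  interpret \<mu>: prob_space \<mu> by (rule prob_space_paths)
  interpret pair_prob_space \<mu> \<mu> ..
  let ?I = "segments k N"
  let ?m = "\<lambda>u w. mass k N u * mass k N w"
  have "(\<Sum>u\<in>?I. \<Sum>w\<in>?I. ?m u w * (card (set u \<inter> set w) / p ^ card (set u \<inter> set w)))
      \<le> (\<Sum>u\<in>?I. \<Sum>w\<in>?I. ?m u w * (\<Sum>n\<le>Suc N. real n / p ^ n * of_bool (n \<le> card (set u \<inter> set w))))"
  proof (intro sum_mono mult_left_mono)
    fix u w assume u: "u \<in> ?I"
    let ?c = "card (set u \<inter> set w)"
    have "?c \<le> card (set u)" by (intro card_mono) auto
    also have "\<dots> \<le> Suc N" using u card_length[of u] by (auto simp: segments_def length_segment)
    finally have "?c \<in> {..Suc N}" by simp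
    then have "real ?c / p ^ ?c * of_bool (?c \<le> ?c) \<le> (\<Sum>n\<le>Suc N. real n / p ^ n * of_bool (n \<le> ?c))"
      using p_pos by (intro member_le_sum) auto
    then show "?c / p ^ ?c \<le> (\<Sum>n\<le>Suc N. real n / p ^ n * of_bool (n \<le> ?c))" by simp
  qed (simp add: mass_nonneg)
  also have "\<dots> = (\<Sum>n\<le>Suc N. real n / p ^ n * (\<Sum>u\<in>?I. \<Sum>w\<in>?I. ?m u w * of_bool (n \<le> card (set u \<inter> set w))))"
    unfolding sum_distrib_left
    by (subst (2) sum.swap, subst sum.swap) (simp add: mult_ac)
  also have "\<dots> \<le> (\<Sum>n\<le>Suc N. real n / p ^ n * measure (\<mu> \<Otimes>\<^sub>M \<mu>) (meet_late \<mu> k n))"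
  proof (intro sum_mono mult_left_mono)
    fix n
    have "{(\<phi>, \<psi>) \<in> space \<mu> \<times> space \<mu>. n \<le> card (set (segment k N \<phi>) \<inter> set (segment k N \<psi>))} \<subseteq> meet_late \<mu> k n"
    proof clarify
      fix \<phi> \<psi> assume "\<phi> \<in> space \<mu>" "\<psi> \<in> space \<mu>"
        and n: "n \<le> card (set (segment k N \<phi>) \<inter> set (segment k N \<psi>))"
      have "set (segment k N \<phi>) \<inter> set (segment k N \<psi>) \<subseteq> \<phi> ` {k..} \<inter> \<psi> ` {k..}"
        by (auto simp: set_segment)
      then have "infinite (\<phi> ` {k..} \<inter> \<psi> ` {k..}) \<or> n \<le> card (\<phi> ` {k..} \<inter> \<psi> ` {k..})"
        using n card_mono order_trans by blast
      then show "(\<phi>, \<psi>) \<in> meet_late \<mu> k n" using \<open>\<phi> \<in> space \<mu>\<close> \<open>\<psi> \<in> space \<mu>\<close> by (simp add: meet_late_def)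
    qed
    then show "(\<Sum>u\<in>?I. \<Sum>w\<in>?I. ?m u w * of_bool (n \<le> card (set u \<inter> set w))) \<le> measure (\<mu> \<Otimes>\<^sub>M \<mu>) (meet_late \<mu> k n)"
      unfolding sum_mass_pairs[where P="\<lambda>u w. n \<le> card (set u \<inter> set w)"]
      by (intro finite_measure_mono meet_late_measurable)
  qed (use p_pos in auto)
  finally show ?thesis .
qed

text \<open>A path visits the finite set \<open>V\<close> only finitely often, so the events of a
  visit after time N decrease to the empty set.\<close>

lemma mass_end_tendsto_0:
  assumes V: "finite V" "V \<subseteq> verts G"
  shows "(\<lambda>N. \<Sum>u\<in>{u \<in> segments k N. head G (last u) \<in> V}. mass k N u) \<longlonglongrightarrow> 0"
proof -
  interpret prob_space \<mu> by (rule prob_space_paths)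
  define D where "D N = {\<phi> \<in> space \<mu>. \<exists>i\<ge>N. tail G (\<phi> i) \<in> V}" for N :: nat
  have D: "D N \<in> sets \<mu>" for N
  proof -
    have [measurable]: "Measurable.pred \<mu> (\<lambda>\<phi>. tail G (\<phi> i) \<in> V)" for i
      by (rule measurable_compose[OF coordinate_measurable]) simp
    show ?thesis unfolding D_def by measurable
  qed
  have "(\<Inter>N. D N) = {}"
  proof (rule ccontr)
    assume "(\<Inter>N. D N) \<noteq> {}"
    then obtain \<phi> where \<phi>: "\<And>N. \<phi> \<in> D N" by blast
    then have "\<phi> \<in> paths_to_infinity G v\<^sub>0" by (auto simp: D_def space_paths)
    then have "finite (\<Union>v\<in>V. {i. tail G (\<phi> i) = v})"
      using V by (auto simp: paths_to_infinity_def)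
    then obtain N where "\<And>i. i \<in> (\<Union>v\<in>V. {i. tail G (\<phi> i) = v}) \<Longrightarrow> i < N"
      by (meson finite_nat_set_iff_bounded)
    with \<phi>[of N] show False by (fastforce simp: D_def)
  qed
  moreover have "(\<lambda>N. measure \<mu> (D N)) \<longlonglongrightarrow> measure \<mu> (\<Inter>N. D N)"
  proof (rule finite_Lim_measure_decseq)
    have "D N \<subseteq> D M" if "M \<le> N" for M N unfolding D_def using le_trans[OF that] by blast
    then show "decseq D" by (simp add: decseq_def)
  qed (use D in auto)
  ultimately have lim: "(\<lambda>N. measure \<mu> (D N)) \<longlonglongrightarrow> 0" by simp
  have le: "(\<Sum>u\<in>{u \<in> segments k N. head G (last u) \<in> V}. mass k N u) \<le> measure \<mu> (D N)" for N
  proof -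
    \<comment> \<open>The head of the last arc is the position at time \<open>Suc (k + N)\<close>,
      which is at least \<open>N\<close>.\<close>
    have "{\<phi> \<in> space \<mu>. segment k N \<phi> \<in> {u \<in> segments k N. head G (last u) \<in> V}} \<subseteq> D N"
    proof
      fix \<phi> assume "\<phi> \<in> {\<phi> \<in> space \<mu>. segment k N \<phi> \<in> {u \<in> segments k N. head G (last u) \<in> V}}"
      then have \<phi>: "\<phi> \<in> space \<mu>" "head G (\<phi> (k + N)) \<in> V" by (simp_all add: last_segment)
      moreover from \<phi>(1) have "\<forall>i. head G (\<phi> i) = tail G (\<phi> (Suc i))"
        by (simp add: space_paths paths_to_infinity_def)
      ultimately have "tail G (\<phi> (Suc (k + N))) \<in> V" by metis
      moreover have "N \<le> Suc (k + N)" by simp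
      ultimately show "\<phi> \<in> D N" unfolding D_def using \<phi>(1) by blast
    qed
    then show ?thesis using finite_measure_mono[OF _ D] by (subst sum_mass) auto
  qed
  show ?thesis
    by (rule tendsto_sandwich[OF _ _ tendsto_const lim])
      (auto intro!: always_eventually sum_nonneg mass_nonneg le)
qed

section \<open>Transience of some open cluster\<close>

text \<open>Strength and energy of the flow carried by the open segments, and the weight of those segments
  that end in a ball: without the last condition the flow need not leave the ball.\<close>

definition good_event :: "nat \<Rightarrow> nat \<Rightarrow> nat \<Rightarrow> ('e \<Rightarrow> bool) set" where
  "good_event k N j = {\<omega> \<in> space (percolation G p).
     1 / 2 \<le> (\<Sum>u\<in>segments k N. mass k N u * open_weight p (set u) \<omega>) \<and>
     (\<Sum>u\<in>segments k N. \<Sum>w\<in>segments k N. mass k N u * open_weight p (set u) \<omega> *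
        (mass k N w * open_weight p (set w) \<omega>) * card (set (loop_erase u) \<inter> set (loop_erase w))) \<le> 1 \<and>
     (\<Sum>u\<in>{u \<in> segments k N. head G (last u) \<in> reach_ball G v\<^sub>0 j}. mass k N u * open_weight p (set u) \<omega>) \<le> 1 / 4}"

text \<open>The order of choices matters: \<open>k\<close> is fixed first, so the possible starting
  vertices form one finite ball, while \<open>N\<close> may depend on the radius \<open>j\<close>
  that the flow has to leave.\<close>

definition flow_event :: "nat \<Rightarrow> ('e \<Rightarrow> bool) set" where
  "flow_event k = (\<Inter>j. \<Union>N. good_event k N j)"

lemma mass_open_weight_nonneg: "0 \<le> mass k N u * open_weight p (set u) \<omega>"
  by (intro mult_nonneg_nonneg mass_nonneg open_weight_nonneg p_pos)

lemma good_event: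
  fixes \<delta> \<eta> :: real
  assumes "(\<Sum>n\<le>Suc N. real n / p ^ n * measure (\<mu> \<Otimes>\<^sub>M \<mu>) (meet_late \<mu> k n)) \<le> \<eta>"
    and "(\<Sum>u\<in>{u \<in> segments k N. head G (last u) \<in> reach_ball G v\<^sub>0 j}. mass k N u) \<le> \<delta>"
  shows "good_event k N j \<in> sets (percolation G p)"
    and "1 - 5 * \<eta> - 4 * \<delta> \<le> measure (percolation G p) (good_event k N j)"
proof -
  have energy: "(\<Sum>u\<in>segments k N. \<Sum>w\<in>segments k N.
      mass k N u * mass k N w * (card (set u \<inter> set w) / p ^ card (set u \<inter> set w))) \<le> \<eta>"
    using segment_energy_le assms(1) by (rule order_trans)
  have "good_event k N j \<in> sets (percolation G p) \<and>
    1 - 5 * \<eta> - 4 * \<delta> \<le> measure (percolation G p) (good_event k N j)"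
    unfolding good_event_def
    by (intro conjI second_moment[OF p_pos p_less_1 finite_segments _ _ _ _ sum_mass_segments _ assms(2) energy])
      (simp_all add: segment_arcs loop_erase_subset mass_nonneg)
  then show "good_event k N j \<in> sets (percolation G p)"
    and "1 - 5 * \<eta> - 4 * \<delta> \<le> measure (percolation G p) (good_event k N j)" by simp_all
qed

lemma good_event_antimono:
  assumes "i \<le> j"
  shows "good_event k N j \<subseteq> good_event k N i"
proof
  fix \<omega> assume \<omega>: "\<omega> \<in> good_event k N j"
  have "(\<Sum>u\<in>{u \<in> segments k N. head G (last u) \<in> reach_ball G v\<^sub>0 i}. mass k N u * open_weight p (set u) \<omega>)
    \<le> (\<Sum>u\<in>{u \<in> segments k N. head G (last u) \<in> reach_ball G v\<^sub>0 j}. mass k N u * open_weight p (set u) \<omega>)"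
    using reach_ball_mono[OF assms, of G v\<^sub>0] finite_segments
    by (intro sum_mono2 mass_open_weight_nonneg) auto
  with \<omega> show "\<omega> \<in> good_event k N i" by (simp add: good_event_def)
qed

lemma good_event_sets: "good_event k N j \<in> sets (percolation G p)"
  by (rule good_event(1)[OF order_refl order_refl])

lemma flow_event_sets: "flow_event k \<in> sets (percolation G p)"
  unfolding flow_event_def using good_event_sets by auto

text \<open>For fixed \<open>j\<close> the mass ending in the ball tends to 0 with growing
  \<open>N\<close>, so its share of the loss disappears. The unions over \<open>N\<close> decrease
  in \<open>j\<close>, so the bound passes to their intersection.\<close>

lemma prob_flow_event:
  assumes "\<And>N. (\<Sum>n\<le>N. real n / p ^ n * measure (\<mu> \<Otimes>\<^sub>M \<mu>) (meet_late \<mu> k n)) \<le> \<eta>"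
  shows "1 - 5 * \<eta> \<le> measure (percolation G p) (flow_event k)"
proof -
  interpret prob_space "percolation G p" by (rule prob_space_percolation)
  have B: "1 - 5 * \<eta> \<le> prob (\<Union>N. good_event k N j)" for j
  proof (rule LIMSEQ_le_const2)
    have "(\<lambda>N. 1 - 5 * \<eta> - 4 * (\<Sum>u\<in>{u \<in> segments k N. head G (last u) \<in> reach_ball G v\<^sub>0 j}. mass k N u)) \<longlonglongrightarrow> 1 - 5 * \<eta> - 4 * 0"
      by (intro tendsto_intros mass_end_tendsto_0 finite_reach_ball reach_ball_verts)
    then show "(\<lambda>N. 1 - 5 * \<eta> - 4 * (\<Sum>u\<in>{u \<in> segments k N. head G (last u) \<in> reach_ball G v\<^sub>0 j}. mass k N u)) \<longlonglongrightarrow> 1 - 5 * \<eta>"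
      by simp
    have "1 - 5 * \<eta> - 4 * (\<Sum>u\<in>{u \<in> segments k N. head G (last u) \<in> reach_ball G v\<^sub>0 j}. mass k N u)
      \<le> prob (\<Union>N. good_event k N j)" for N
    proof -
      have "prob (good_event k N j) \<le> prob (\<Union>N. good_event k N j)"
        using good_event_sets by (intro finite_measure_mono) auto
      with good_event(2)[OF assms order_refl] show ?thesis by (rule order_trans)
    qed
    then show "\<exists>M. \<forall>N\<ge>M. 1 - 5 * \<eta> - 4 * (\<Sum>u\<in>{u \<in> segments k N. head G (last u) \<in> reach_ball G v\<^sub>0 j}. mass k N u)
      \<le> prob (\<Union>N. good_event k N j)" by blast
  qed
  have "(\<lambda>j. prob (\<Union>N. good_event k N j)) \<longlonglongrightarrow> prob (\<Inter>j. \<Union>N. good_event k N j)"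
  proof (rule finite_Lim_measure_decseq)
    show "range (\<lambda>j. \<Union>N. good_event k N j) \<subseteq> events" using good_event_sets by auto
    show "decseq (\<lambda>j. \<Union>N. good_event k N j)"
      unfolding decseq_def using good_event_antimono by (intro allI impI UN_mono) auto
  qed
  then show ?thesis unfolding flow_event_def using B by (intro LIMSEQ_le_const) auto
qed

section \<open>From open flows to transience\<close>

lemma open_reachable_reach_ball:
  assumes "x \<in> reach_ball G v\<^sub>0 k" "y \<in> verts (open_cluster G \<omega> x)"
  shows "\<exists>j. y \<in> reach_ball G v\<^sub>0 j"
proof -
  interpret O: wf_digraph "open_subgraph G \<omega>" by (rule wf_digraph_open_subgraph[OF wf])
  have "x \<rightarrow>\<^sup>*\<^bsub>open_subgraph G \<omega>\<^esub> y" using assms(2) by (simp add: verts_open_cluster[OF wf])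
  then show ?thesis
  proof (induction rule: O.reachable_induct)
    case base
    then show ?case using assms(1) by blast
  next
    case (step y z)
    then obtain j where j: "y \<in> reach_ball G v\<^sub>0 j" by blast
    from step(2) obtain e where "e \<in> out_arcs G y" "head G e = z" by (auto elim!: reachableE)
    with j have "z \<in> (\<Union>x\<in>reach_ball G v\<^sub>0 j. head G ` out_arcs G x)" by blast
    then have "z \<in> reach_ball G v\<^sub>0 (Suc j)" by simp
    then show ?case by blast
  qed
qed

text \<open>At least 1/2 - 1/4 = 1/4 of the flow ends outside the ball of radius \<open>j\<close>,
  where \<open>g\<close> vanishes. Some starting vertex carries an equal share or more, with energy
  still at most 1. The resulting constant depends on \<open>k\<close> alone.\<close>

lemma good_event_flow:
  assumes \<omega>: "\<omega> \<in> good_event k N j"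
  shows "\<exists>v\<in>reach_ball G v\<^sub>0 k. \<forall>g :: 'v \<Rightarrow> real. finite {y. g y \<noteq> 0} \<longrightarrow> {y. g y \<noteq> 0} \<subseteq> reach_ball G v\<^sub>0 j \<longrightarrow>
    (g v)\<^sup>2 \<le> (4 * real (card (reach_ball G v\<^sub>0 k)))\<^sup>2 * dirichlet_energy (open_cluster G \<omega> v) g"
proof -
  let ?V = "reach_ball G v\<^sub>0 k"
  let ?S = "segments k N"
  define c where "c = real (card ?V)"
  define a where "a u = mass k N u * open_weight p (set u) \<omega>" for u
  define I where "I = {u \<in> ?S. head G (last u) \<notin> reach_ball G v\<^sub>0 j}"
  define Iv where "Iv v = {u \<in> I. tail G (hd u) = v}" for v
  have fI: "finite I" by (simp add: I_def finite_segments)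
  have a0: "0 \<le> a u" for u unfolding a_def by (rule mass_open_weight_nonneg)
  have \<omega>': "1 / 2 \<le> sum a ?S" "sum a {u \<in> ?S. head G (last u) \<in> reach_ball G v\<^sub>0 j} \<le> 1 / 4"
    and W: "(\<Sum>u\<in>?S. \<Sum>w\<in>?S. a u * a w * card (set (loop_erase u) \<inter> set (loop_erase w))) \<le> 1"
    using \<omega> by (simp_all add: good_event_def a_def)
  have "?S - {u \<in> ?S. head G (last u) \<in> reach_ball G v\<^sub>0 j} = I" by (auto simp: I_def)
  then have "sum a I = sum a ?S - sum a {u \<in> ?S. head G (last u) \<in> reach_ball G v\<^sub>0 j}"
    using sum_diff[OF finite_segments, of "{u \<in> ?S. head G (last u) \<in> reach_ball G v\<^sub>0 j}" k N a] by simp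
  with \<omega>' have I: "1 / 4 \<le> sum a I" by simp
  have "(\<lambda>u. tail G (hd u)) ` I \<subseteq> ?V" using segment_start by (auto simp: I_def)
  from sum.group[OF fI finite_reach_ball this, of a]
  have group: "(\<Sum>v\<in>?V. sum a (Iv v)) = sum a I" by (simp add: Iv_def)
  \<comment> \<open>Pigeonhole over the starting vertices.\<close>
  obtain v where v: "v \<in> ?V" "1 / (4 * c) \<le> sum a (Iv v)"
  proof (rule ccontr)
    assume n: "\<not> thesis"
    have "?V \<noteq> {}" using group I by auto
    then have c: "0 < c" using finite_reach_ball by (auto simp: c_def card_gt_0_iff)
    have "(\<Sum>v\<in>?V. sum a (Iv v)) < (\<Sum>v\<in>?V. 1 / (4 * c))"
      using n that \<open>?V \<noteq> {}\<close> by (intro sum_strict_mono finite_reach_ball) (auto simp: not_le[symmetric])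
    also have "\<dots> = 1 / 4" using c by (simp add: c_def)
    finally show False using group I by simp
  qed
  have c: "0 < c" using v(1) finite_reach_ball by (auto simp: c_def card_gt_0_iff)
  have IvS: "Iv v \<subseteq> ?S" by (auto simp: Iv_def I_def)
  have Wv: "(\<Sum>u\<in>Iv v. \<Sum>w\<in>Iv v. a u * a w * card (set (loop_erase u) \<inter> set (loop_erase w))) \<le> 1"
  proof -
    have "(\<Sum>u\<in>Iv v. \<Sum>w\<in>Iv v. a u * a w * card (set (loop_erase u) \<inter> set (loop_erase w)))
      \<le> (\<Sum>u\<in>Iv v. \<Sum>w\<in>?S. a u * a w * card (set (loop_erase u) \<inter> set (loop_erase w)))"
      using a0 IvS finite_segments by (intro sum_mono sum_mono2) auto
    also have "\<dots> \<le> (\<Sum>u\<in>?S. \<Sum>w\<in>?S. a u * a w * card (set (loop_erase u) \<inter> set (loop_erase w)))"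
      using a0 IvS finite_segments by (intro sum_mono2) (auto intro!: sum_nonneg)
    finally show ?thesis using W by simp
  qed
  show ?thesis
  proof (intro bexI[OF _ v(1)] allI impI)
    fix g :: "'v \<Rightarrow> real"
    assume g: "finite {y. g y \<noteq> 0}" "{y. g y \<noteq> 0} \<subseteq> reach_ball G v\<^sub>0 j"
    let ?D = "dirichlet_energy (open_cluster G \<omega> v) g"
    have "(sum a (Iv v) * g v)\<^sup>2
      \<le> (\<Sum>u\<in>Iv v. \<Sum>w\<in>Iv v. a u * a w * card (set (loop_erase u) \<inter> set (loop_erase w))) * ?D"
    proof (rule flow_le_dirichlet_energy[OF wf fin])
      fix u assume u: "u \<in> Iv v" "a u \<noteq> 0"
      then have "\<forall>e\<in>set u. \<omega> e" by (simp add: a_def open_weight_def split: if_splits)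
      with u show "pre_digraph.trail (open_subgraph G \<omega>) v (loop_erase u) (head G (last u))"
        using loop_erase_trail[of u k N \<omega>] by (auto simp: Iv_def I_def)
      show "g (head G (last u)) = 0" using u g(2) by (auto simp: Iv_def I_def)
    qed (use g a0 fI in \<open>auto simp: Iv_def\<close>)
    also have "\<dots> \<le> 1 * ?D" by (intro mult_right_mono Wv dirichlet_energy_nonneg)
    finally have *: "(sum a (Iv v))\<^sup>2 * (g v)\<^sup>2 \<le> ?D" by (simp add: power_mult_distrib)
    have "1 \<le> (4 * c) * sum a (Iv v)" using v(2) c by (simp add: field_simps)
    then have "1\<^sup>2 \<le> ((4 * c) * sum a (Iv v))\<^sup>2" by (intro power_mono) auto
    then have "1 * (g v)\<^sup>2 \<le> ((4 * c) * sum a (Iv v))\<^sup>2 * (g v)\<^sup>2" by (intro mult_right_mono) auto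
    also have "\<dots> = (4 * c)\<^sup>2 * ((sum a (Iv v))\<^sup>2 * (g v)\<^sup>2)" by (simp add: power_mult_distrib mult_ac)
    also have "\<dots> \<le> (4 * c)\<^sup>2 * ?D" by (intro mult_left_mono *) auto
    finally show "(g v)\<^sup>2 \<le> (4 * real (card ?V))\<^sup>2 * ?D" by (simp add: c_def)
  qed
qed

text \<open>The vertex found for radius \<open>j\<close> may vary with \<open>j\<close>. If every
  vertex of the finite starting ball had a violating \<open>g\<close>, all these supports would fit
  into one ball, and the flow leaving that ball would give a contradiction.\<close>

lemma flow_event_transient:
  assumes \<omega>: "\<omega> \<in> flow_event k"
  shows "\<exists>v\<in>verts G. transient (open_cluster G \<omega> v)"
proof -
  let ?V = "reach_ball G v\<^sub>0 k" and ?K = "(4 * real (card (reach_ball G v\<^sub>0 k)))\<^sup>2"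
  let ?ok = "\<lambda>v g. (g v)\<^sup>2 \<le> ?K * dirichlet_energy (open_cluster G \<omega> v) g"
  have "\<exists>v\<in>?V. \<forall>g. finite {y. g y \<noteq> 0} \<longrightarrow> {y. g y \<noteq> 0} \<subseteq> verts (open_cluster G \<omega> v) \<longrightarrow> ?ok v g"
  proof (rule ccontr)
    assume "\<not> ?thesis"
    then have "\<forall>v\<in>?V. \<exists>g. finite {y. g y \<noteq> 0} \<and> {y. g y \<noteq> 0} \<subseteq> verts (open_cluster G \<omega> v) \<and> \<not> ?ok v g"
      by blast
    then obtain g where g: "\<And>v. v \<in> ?V \<Longrightarrow> finite {y. g v y \<noteq> 0}"
      "\<And>v. v \<in> ?V \<Longrightarrow> {y. g v y \<noteq> 0} \<subseteq> verts (open_cluster G \<omega> v)" "\<And>v. v \<in> ?V \<Longrightarrow> \<not> ?ok v (g v)"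
      by metis
    let ?F = "\<Union>v\<in>?V. {y. g v y \<noteq> 0}"
    have "finite ?F" using g(1) finite_reach_ball by blast
    moreover have "\<forall>y\<in>?F. \<exists>j. y \<in> reach_ball G v\<^sub>0 j" using g(2) open_reachable_reach_ball by blast
    then obtain r where r: "\<And>y. y \<in> ?F \<Longrightarrow> y \<in> reach_ball G v\<^sub>0 (r y)" by metis
    ultimately obtain j where le_j: "\<And>y. y \<in> ?F \<Longrightarrow> r y \<le> j"
      by (metis finite_imageI finite_nat_set_iff_bounded_le imageI)
    have j: "?F \<subseteq> reach_ball G v\<^sub>0 j"
    proof
      fix y assume y: "y \<in> ?F"
      show "y \<in> reach_ball G v\<^sub>0 j" by (rule subsetD[OF reach_ball_mono[OF le_j[OF y]] r[OF y]])
    qed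
    from \<omega> obtain N where "\<omega> \<in> good_event k N j" by (auto simp: flow_event_def)
    from good_event_flow[OF this] obtain v where v: "v \<in> ?V"
      "\<And>g :: 'v \<Rightarrow> real. finite {y. g y \<noteq> 0} \<Longrightarrow> {y. g y \<noteq> 0} \<subseteq> reach_ball G v\<^sub>0 j \<Longrightarrow> ?ok v g" by blast
    have "{y. g v y \<noteq> 0} \<subseteq> reach_ball G v\<^sub>0 j" using j v(1) by blast
    from v(2)[OF g(1)[OF v(1)] this] g(3)[OF v(1)] show False by simp
  qed
  then obtain v where v: "v \<in> ?V"
    "\<And>g. finite {y. g y \<noteq> 0} \<Longrightarrow> {y. g y \<noteq> 0} \<subseteq> verts (open_cluster G \<omega> v) \<Longrightarrow> ?ok v g" by blast
  then have "v \<in> verts G" using reach_ball_verts by blast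
  with transient_open_cluster[OF wf fin this v(2)] show ?thesis by blast
qed

text \<open>A suitable \<open>k\<close> gives \<open>flow_event k\<close> probability at least 1 -
  \<epsilon>, so the union over \<open>k\<close> is a measurable event of probability 1 on which
  some cluster is transient.\<close>

lemma AE_transient: "AE \<omega> in percolation G p. \<exists>v\<in>verts G. transient (open_cluster G \<omega> v)"
proof -
  interpret prob_space "percolation G p" by (rule prob_space_percolation)
  have ev: "(\<Union>k. flow_event k) \<in> events" using flow_event_sets by auto
  have "1 \<le> prob (\<Union>k. flow_event k)"
  proof (rule field_le_epsilon)
    fix \<epsilon> :: real assume "0 < \<epsilon>"
    \<comment> \<open>The divisor 5 offsets the factor 5 lost in
      \<open>prob_flow_event\<close>.\<close>
    then obtain k where "\<And>N. (\<Sum>n\<le>N. real n / p ^ n * measure (\<mu> \<Otimes>\<^sub>M \<mu>) (meet_late \<mu> k n)) \<le> \<epsilon> / 5"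
      using weighted_meet_late_small[of "\<epsilon> / 5"] by auto
    from prob_flow_event[OF this] have "1 - \<epsilon> \<le> prob (flow_event k)" by simp
    also have "\<dots> \<le> prob (\<Union>k. flow_event k)" using ev by (intro finite_measure_mono) auto
    finally show "1 \<le> prob (\<Union>k. flow_event k) + \<epsilon>" by simp
  qed
  then have "AE \<omega> in percolation G p. \<omega> \<in> (\<Union>k. flow_event k)"
    using ev prob_le_1 by (intro AE_prob_1) (auto intro: antisym)
  then show ?thesis by eventually_elim (use flow_event_transient in blast)
qed

end

theorem proposition1p2:
  fixes G :: "('v, 'e) pre_digraph" and \<theta> p :: real
  assumes "wf_digraph G" and "infinite (verts G)" and "locally_finite G"
    and "0 < \<theta>" and "\<theta> < 1"
    and "admits_EIT_paths G \<theta>"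
    and "0 < p" and "p < 1"
    and "\<theta> < p"
  shows "AE \<omega> in percolation G p. \<exists>v\<in>verts G. transient (open_cluster G \<omega> v)"
proof -
  obtain v\<^sub>0 \<mu> where "v\<^sub>0 \<in> verts G" "borel_prob_on_paths G v\<^sub>0 \<mu>" "EIT \<mu> \<theta>"
    using assms(6) by (auto simp: admits_EIT_paths_def)
  with assms interpret EIT_paths G v\<^sub>0 \<mu> \<theta> p
    by (simp add: EIT_paths_def)
  show ?thesis by (rule AE_transient)
qed

end
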